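(* Let $A_1$ and $A_2$ be unital $C^*$-algebras. Suppose that $\phi\colon A_{1+}\to A_{2+}$ is a positively homogeneous order isomorphism, that is: (1) $\phi$ is a bijection; (2) $\phi(tx)=t\phi(x)$ for all $x\in A_{1+}$ and all real $t\ge 0$; (3) for all $x,x'\in A_{1+}$, $x\le x'$ if and only if $\phi(x)\le\phi(x')$. Then there exists a Jordan $*$-isomorphism $J\colon A_1\to A_2$ such that $\phi(x)=\phi(e)^{1/2}J(x)\phi(e)^{1/2}$ for all $x\in A_{1+}$.
   Context: For a unital $C^*$-algebra $A$ (unit always denoted $e$), $A_+$ denotes the positive semidefinite cone of $A$, i.e. the set of all positive elements $a\ge 0$ of $A$ (not necessarily invertible); $A_{j+}$ denotes this cone for $A=A_j$. The order is the usual one on self-adjoint elements: $a\le b$ iff $b-a$ is positive. A Jordan $*$-isomorphism $J\colon A_1\to A_2$ is a complex linear bijection that preserves the Jordan product $(ab+ba)/2$ and the involution. *)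

theory Defs
  imports "HOL-Analysis.Analysis"
begin

class scaleC = scaleR +
  fixes scaleC :: "complex \<Rightarrow> 'a \<Rightarrow> 'a"  (infixr "*\<^sub>C" 75)
  assumes scaleR_scaleC: "r *\<^sub>R x = complex_of_real r *\<^sub>C x"

class star =
  fixes star :: "'a \<Rightarrow> 'a"

text \<open>The unit is supplied by the class \<^class>\<open>monoid_mult\<close> rather than by
  \<^class>\<open>real_normed_algebra_1\<close>, so that the zero algebra is not excluded; when
  \<open>1 \<noteq> 0\<close>, the equation \<open>norm 1 = 1\<close> follows from the C*-identity. Submultiplicativity
  of the norm and completeness come from the classes \<^class>\<open>real_normed_algebra\<close>
  and \<^class>\<open>banach\<close>.\<close>

class unital_cstar_algebra = monoid_mult + real_normed_algebra + banach + scaleC + star +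
  assumes scaleC_add_right: "c *\<^sub>C (x + y) = c *\<^sub>C x + c *\<^sub>C y"
    and scaleC_add_left: "(c + d) *\<^sub>C x = c *\<^sub>C x + d *\<^sub>C x"
    and scaleC_scaleC: "c *\<^sub>C d *\<^sub>C x = (c * d) *\<^sub>C x"
    and scaleC_one: "1 *\<^sub>C x = x"
    and norm_scaleC: "norm (c *\<^sub>C x) = cmod c * norm x"
    and mult_scaleC_left: "(c *\<^sub>C x) * y = c *\<^sub>C (x * y)"
    and mult_scaleC_right: "x * (c *\<^sub>C y) = c *\<^sub>C (x * y)"
    and star_star: "star (star x) = x"
    and star_add: "star (x + y) = star x + star y"
    and star_scaleC: "star (c *\<^sub>C x) = cnj c *\<^sub>C star x"
    and star_mult: "star (x * y) = star y * star x"
    and cstar_identity: "norm (star x * x) = (norm x)\<^sup>2"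

definition cstar_invertible :: "'a::unital_cstar_algebra \<Rightarrow> bool"
  where "cstar_invertible x \<longleftrightarrow> (\<exists>y. x * y = 1 \<and> y * x = 1)"

definition cstar_spectrum :: "'a::unital_cstar_algebra \<Rightarrow> complex set"
  where "cstar_spectrum x = {c. \<not> cstar_invertible (c *\<^sub>C 1 - x)}"

definition selfadjoint :: "'a::unital_cstar_algebra \<Rightarrow> bool"
  where "selfadjoint x \<longleftrightarrow> star x = x"

definition pos_cone :: "'a::unital_cstar_algebra set"
  where "pos_cone = {x. selfadjoint x \<and> cstar_spectrum x \<subseteq> \<real>\<^sub>\<ge>\<^sub>0}"

definition cstar_le :: "'a::unital_cstar_algebra \<Rightarrow> 'a \<Rightarrow> bool"  (infix "\<preceq>" 50)
  where "x \<preceq> y \<longleftrightarrow> selfadjoint x \<and> selfadjoint y \<and> y - x \<in> pos_cone"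

text \<open>The square root is meaningful for arguments in \<^const>\<open>pos_cone\<close> only,
  where it is the unique positive element with the given square.\<close>

definition cstar_sqrt :: "'a::unital_cstar_algebra \<Rightarrow> 'a"
  where "cstar_sqrt x = (THE y. y \<in> pos_cone \<and> y * y = x)"

definition jordan_prod :: "'a::unital_cstar_algebra \<Rightarrow> 'a \<Rightarrow> 'a"
  where "jordan_prod x y = (1/2 :: real) *\<^sub>R (x * y + y * x)"

definition jordan_star_iso :: "('a::unital_cstar_algebra \<Rightarrow> 'b::unital_cstar_algebra) \<Rightarrow> bool"
  where "jordan_star_iso J \<longleftrightarrow>
    bij J \<and>
    (\<forall>x y. J (x + y) = J x + J y) \<and>
    (\<forall>c x. J (c *\<^sub>C x) = c *\<^sub>C J x) \<and>
    (\<forall>x y. J (jordan_prod x y) = jordan_prod (J x) (J y)) \<and>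
    (\<forall>x. J (star x) = star (J x))"

end

theory Submission
  imports Defs
begin

text \<open>
  After normalising \<open>\<phi> 1 = 1\<close>, the map \<open>\<phi>\<close> and its inverse preserve the Thompson metric on the
  invertible positive elements. Vaisala's reflection argument for the Mazur--Ulam theorem, with the
  reflections \<open>x \<mapsto> c x\<^sup>-\<^sup>1 c\<close>, shows that \<open>\<phi>\<close> preserves geometric means, hence
  \<open>\<phi> (c x c) = \<phi> c \<phi> x \<phi> c\<close>. Applied near \<open>1\<close>, this identity makes the difference quotients of
  \<open>\<phi>\<close> at \<open>1\<close> converge (along \<open>2\<^sup>-\<^sup>n\<close>) to an additive map \<open>D\<close>, a unital linear order isomorphism of
  the self-adjoint parts. Kadison's inequality for \<open>D\<close> and \<open>D\<^sup>-\<^sup>1\<close> gives \<open>D (a\<^sup>2) = (D a)\<^sup>2\<close>, and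
  comparing repeated squares of elements close to \<open>1\<close> yields \<open>\<phi> = D\<close>.

  Positivity is handled through the real-algebraic criterion \<open>\<parallel>t - a\<parallel> \<le> t\<close>. The spectral radius
  formula is replaced by the fact that \<open>1 - a\<^sup>2\<close> is not invertible if \<open>a\<close> is self-adjoint of norm \<open>1\<close>.
\<close>

section \<open>Self-adjoint elements and positivity\<close>

text \<open>Since \<open>\<phi>\<close> is assumed neither additive nor continuous, linearity has to
  come out of order and scaling alone. These two define the Thompson metric, which is finite between
  invertible positive elements but infinite from \<open>1\<close> to any boundary point of the cone;
  so the metric argument lives on \<open>ppos\<close>, and the other elements are reached at the end
  by adding small multiples of an interior point. The identity for \<open>c x c\<close> is
  multiplicative; additivity is its first order part at \<open>1\<close>, which is why a derivative
  appears at all. Step sizes are dyadic because \<open>\<phi>\<close> respects squaring and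
  \<open>(1 + s a)^2 = 1 + 2 s a + O(s^2)\<close>. No functional calculus enters: absolute values
  and geometric means are built from a square root that commutes with everything commuting with its
  square.\<close>

lemma star_zero [simp]: "star (0::'a::unital_cstar_algebra) = 0"
  using star_add[of "0::'a" 0] by simp

lemma star_one [simp]: "star (1::'a::unital_cstar_algebra) = 1"
  by (metis mult.right_neutral star_mult star_star)

lemma star_scaleR [simp]: "star (r *\<^sub>R x) = r *\<^sub>R star (x::'a::unital_cstar_algebra)"
  by (simp add: scaleR_scaleC star_scaleC)

lemma star_minus [simp]: "star (- x) = - star (x::'a::unital_cstar_algebra)"
  using star_add[of x "-x"] by (simp add: eq_neg_iff_add_eq_0 add.commute)

lemma star_diff [simp]: "star (x - y) = star x - star (y::'a::unital_cstar_algebra)"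
  using star_add[of x "-y"] by simp

lemma norm_star [simp]: "norm (star x) = norm (x::'a::unital_cstar_algebra)"
proof -
  have *: "norm y \<le> norm (star y)" for y :: 'a
  proof (cases "y = 0")
    case False
    have "norm y * norm y \<le> norm (star y) * norm y"
      using norm_mult_ineq[of "star y" y] by (simp add: cstar_identity power2_eq_square)
    then show ?thesis using False by simp
  qed simp
  show ?thesis using *[of x] *[of "star x"] by (simp add: star_star)
qed

lemma bounded_linear_star: "bounded_linear (star :: 'a::unital_cstar_algebra \<Rightarrow> 'a)"
  by (rule bounded_linear_intro[where K = 1]) (simp_all add: star_add)

text \<open>An inequality, not an equation: in the zero algebra the unit has norm
  \<open>0\<close>.\<close>

lemma norm_one_le: "norm (1::'a::unital_cstar_algebra) \<le> 1"
proof -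
  have "norm (1::'a) = (norm (1::'a))\<^sup>2" using cstar_identity[of "1::'a"] by simp
  then show ?thesis by (auto simp: power2_eq_square)
qed

lemma norm_scaleR_one_le: "norm (r *\<^sub>R (1::'a::unital_cstar_algebra)) \<le> \<bar>r\<bar>"
  using norm_one_le[where 'a='a] by (simp add: mult_left_le)

lemma scaleC_i_i: "\<i> *\<^sub>C \<i> *\<^sub>C x = - (x::'a::unital_cstar_algebra)"
proof -
  have "\<i> *\<^sub>C \<i> *\<^sub>C x = (-1::real) *\<^sub>R x" by (simp add: scaleC_scaleC scaleR_scaleC)
  then show ?thesis by simp
qed

lemma scaleC_zero_right [simp]: "c *\<^sub>C (0::'a::unital_cstar_algebra) = 0"
  using scaleC_add_right[of c "0::'a" 0] by simp

lemma scaleC_minus_right: "c *\<^sub>C (- x) = - (c *\<^sub>C (x::'a::unital_cstar_algebra))"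
  using scaleC_add_right[of c x "-x"] by (simp add: eq_neg_iff_add_eq_0 add.commute)

lemma scaleC_diff_right: "c *\<^sub>C (x - y) = c *\<^sub>C x - c *\<^sub>C (y::'a::unital_cstar_algebra)"
  using scaleC_add_right[of c x "-y"] by (simp add: scaleC_minus_right)

lemma scaleC_scaleR: "c *\<^sub>C r *\<^sub>R x = r *\<^sub>R c *\<^sub>C (x::'a::unital_cstar_algebra)"
  by (simp add: scaleR_scaleC scaleC_scaleC mult.commute)

lemma scaleC_complex: "c *\<^sub>C x = Re c *\<^sub>R x + \<i> *\<^sub>C Im c *\<^sub>R (x::'a::unital_cstar_algebra)"
proof -
  have "c = complex_of_real (Re c) + \<i> * complex_of_real (Im c)" by (simp add: complex_eq_iff)
  then show ?thesis by (metis scaleC_add_left scaleC_scaleC scaleR_scaleC)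
qed

lemma star_scaleC_i: "star (\<i> *\<^sub>C x) = - (\<i> *\<^sub>C star (x::'a::unital_cstar_algebra))"
  by (metis (no_types, lifting) complex_cnj_i minus_mult_left mult_1 of_real_1 of_real_minus scaleC_scaleC
      scaleR_minus1_left scaleR_scaleC star_scaleC)

lemma sa_star: "selfadjoint x \<Longrightarrow> star x = x" by (simp add: selfadjoint_def)
lemma sa_0 [simp, intro]: "selfadjoint 0" by (simp add: selfadjoint_def)
lemma sa_1 [simp, intro]: "selfadjoint 1" by (simp add: selfadjoint_def)
lemma sa_scaleR [simp, intro]: "selfadjoint x \<Longrightarrow> selfadjoint (r *\<^sub>R x)" by (simp add: selfadjoint_def)
lemma sa_add [simp, intro]: "selfadjoint x \<Longrightarrow> selfadjoint y \<Longrightarrow> selfadjoint (x + y)" by (simp add: selfadjoint_def star_add)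
lemma sa_diff [simp, intro]: "selfadjoint x \<Longrightarrow> selfadjoint y \<Longrightarrow> selfadjoint (x - y)" by (simp add: selfadjoint_def)
lemma sa_minus [simp, intro]: "selfadjoint x \<Longrightarrow> selfadjoint (- x)" by (simp add: selfadjoint_def)
lemma sa_sq [simp, intro]: "selfadjoint x \<Longrightarrow> selfadjoint (x * x)" by (simp add: selfadjoint_def star_mult)
lemma sa_conj [simp, intro]: "selfadjoint c \<Longrightarrow> selfadjoint x \<Longrightarrow> selfadjoint (c * x * c)"
  by (simp add: selfadjoint_def star_mult mult.assoc)
lemma sa_mult: "selfadjoint x \<Longrightarrow> selfadjoint y \<Longrightarrow> x * y = y * x \<Longrightarrow> selfadjoint (x * y)"
  by (simp add: selfadjoint_def star_mult)

lemma sa_norm_sq: "selfadjoint a \<Longrightarrow> norm (a * a) = (norm a)\<^sup>2"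
  using cstar_identity[of a] by (simp add: sa_star)

lemma sa_limit: "X \<longlonglongrightarrow> l \<Longrightarrow> (\<And>n. selfadjoint (X n)) \<Longrightarrow> selfadjoint l"
  using bounded_linear.tendsto[OF bounded_linear_star, of X l sequentially]
    LIMSEQ_unique[of X "star l" l]
  by (simp add: selfadjoint_def)

section \<open>Invertibility, the Neumann series and square roots near \<open>1\<close>\<close>

lemma invertible_scaleR:
  assumes "cstar_invertible x" "r \<noteq> 0" shows "cstar_invertible (r *\<^sub>R x)"
proof -
  obtain y where "x * y = 1" "y * x = 1" using assms(1) by (auto simp: cstar_invertible_def)
  then show ?thesis unfolding cstar_invertible_def using assms(2)
    by (intro exI[of _ "(1/r) *\<^sub>R y"]) simp
qed

lemma invertible_commuting_factor:
  assumes "cstar_invertible (x * y)" "x * y = y * x" shows "cstar_invertible x"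
proof -
  obtain z where z: "x * y * z = 1" "z * (x * y) = 1" using assms(1) by (auto simp: cstar_invertible_def)
  have 1: "(z * y) * x = 1" using z(2) assms(2) by (simp add: mult.assoc)
  have 2: "x * (y * z) = 1" using z(1) by (simp add: mult.assoc)
  have "z * y = z * y * (x * (y * z))" using 2 by simp
  also have "\<dots> = y * z" using 1 by (simp add: mult.assoc[symmetric])
  finally show ?thesis using 1 2 unfolding cstar_invertible_def by metis
qed

lemma invertible_mult:
  assumes "cstar_invertible x" "cstar_invertible y" shows "cstar_invertible (x * y)"
proof -
  obtain u v where "x * u = 1" "u * x = 1" "y * v = 1" "v * y = 1"
    using assms by (auto simp: cstar_invertible_def)
  then have "x * y * (v * u) = 1" "v * u * (x * y) = 1"
    by (metis mult.assoc mult.right_neutral)+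
  then show ?thesis unfolding cstar_invertible_def by blast
qed

lemma invertible_one_minus:
  assumes "norm (x::'a::unital_cstar_algebra) < 1" shows "cstar_invertible (1 - x)"
proof -
  have le: "norm (x ^ Suc n) \<le> norm x ^ Suc n" for n
  proof (induction n)
    case (Suc n)
    have "norm (x ^ Suc (Suc n)) \<le> norm x * norm (x ^ Suc n)"
      using norm_mult_ineq[of x "x ^ Suc n"] by simp
    also have "\<dots> \<le> norm x * norm x ^ Suc n" using Suc by (intro mult_left_mono) auto
    finally show ?case by simp
  qed simp
  have "summable (\<lambda>n. norm x ^ Suc n)" 
    using assms summable_geometric[of "norm x"] summable_Suc_iff[of "\<lambda>n. norm x ^ n"] by simp
  then have "summable (\<lambda>n. x ^ Suc n)"
    by (rule summable_comparison_test'[where N = 0]) (use le in auto)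
  then have s: "summable (\<lambda>n. x ^ n)" using summable_Suc_iff[of "\<lambda>n. x ^ n"] by blast
  define S where "S = (\<Sum>n. x ^ n)"
  have 0: "(\<Sum>n. x ^ Suc n) = S - 1" unfolding S_def using suminf_split_head[OF s] by simp
  have 1: "x * S = S - 1" using suminf_mult[OF s, of x] 0 S_def by simp
  have 2: "S * x = S - 1" using suminf_mult2[OF s, of x] 0 S_def by (simp add: power_commutes)
  show ?thesis unfolding cstar_invertible_def
    by (rule exI[of _ S]) (use 1 2 in \<open>simp add: algebra_simps\<close>)
qed

text \<open>\<open>a + \<mu>\<close> is \<open>t + \<mu>\<close> times \<open>1 - ?x\<close>, where
  \<open>?x = (t - a)/(t + \<mu>)\<close> has norm below \<open>1\<close>, so the Neumann series
  applies. A bound on \<open>t - a\<close> thereby keeps negative numbers out of the spectrum of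
  \<open>a\<close>.\<close>

lemma invertible_add_scalar:
  assumes "norm (t *\<^sub>R 1 - a) < t + \<mu>" shows "cstar_invertible (a + \<mu> *\<^sub>R 1)"
proof -
  let ?x = "(1 / (t + \<mu>)) *\<^sub>R (t *\<^sub>R 1 - a)"
  have p: "t + \<mu> > 0" using assms norm_ge_zero order.strict_trans1 by blast
  then have "norm ?x < 1" using assms by simp
  then have "cstar_invertible ((t + \<mu>) *\<^sub>R (1 - ?x))"
    using p by (intro invertible_scaleR invertible_one_minus) auto
  also have "(t + \<mu>) *\<^sub>R (1 - ?x) = a + \<mu> *\<^sub>R 1"
  proof -
    have "(t + \<mu>) *\<^sub>R ?x = t *\<^sub>R 1 - a" using p by simp
    then show ?thesis by (simp only: scaleR_diff_right[of "t + \<mu>"]) (simp add: scaleR_add_left)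
  qed
  finally show ?thesis .
qed

lemma inverse_commute:
  fixes x :: "'a::monoid_mult"
  assumes "x * y = 1" "y * x = 1" "w * x = x * w" shows "w * y = y * w"
proof -
  have "w * y = y * x * w * y" using assms(2) by simp
  also have "\<dots> = y * (w * x) * y" using assms(3) by (simp add: mult.assoc)
  also have "\<dots> = y * w" using assms(1) by (simp add: mult.assoc)
  finally show ?thesis .
qed

lemma sa_inverse:
  assumes "x * y = 1" "y * x = 1" "selfadjoint x" shows "selfadjoint y"
proof -
  have "star y * x = 1" using assms star_mult[of x y] by (simp add: sa_star)
  then have "star y = y" by (metis assms(1) mult.assoc mult.right_neutral mult_1)
  then show ?thesis by (simp add: selfadjoint_def)
qed

text \<open>The iteration \<open>y \<mapsto> (x + y\<^sup>2)/2\<close> converges to \<open>1 - \<surd>(1 - x)\<close>; it is dominated in norm by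
  the same iteration for the scalar \<open>1\<close>.\<close>

lemma sqrt_one_minus:
  fixes x :: "'a::unital_cstar_algebra"
  assumes "selfadjoint x" "norm x \<le> 1"
  obtains d where "selfadjoint d" "d * d = 1 - x" "norm (1 - d) \<le> 1"
    "\<And>w. w * x = x * w \<Longrightarrow> w * d = d * w"
proof -
  define t :: "nat \<Rightarrow> real" where "t n = ((\<lambda>s. (1 + s\<^sup>2) / 2) ^^ n) 0" for n
  define y where "y n = ((\<lambda>z. (1/2) *\<^sub>R (x + z * z)) ^^ n) 0" for n
  have t_simps: "t 0 = 0" "t (Suc n) = (1 + (t n)\<^sup>2) / 2" for n by (simp_all add: t_def)
  have y_simps: "y 0 = 0" "y (Suc n) = (1/2) *\<^sub>R (x + y n * y n)" for n by (simp_all add: y_def)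
  have t_bounds: "0 \<le> t n \<and> t n \<le> 1" for n
  proof (induction n)
    case (Suc n)
    then have "(t n)\<^sup>2 \<le> 1" by (simp add: power_le_one)
    then show ?case by (simp add: t_simps)
  qed (simp add: t_simps)
  have y_norm: "norm (y n) \<le> t n" for n
  proof (induction n)
    case (Suc n)
    have "norm (y n * y n) \<le> (t n)\<^sup>2"
      using norm_mult_ineq[of "y n" "y n"] mult_mono[OF Suc Suc] t_bounds[of n]
      by (simp add: power2_eq_square)
    then have "norm (x + y n * y n) \<le> 1 + (t n)\<^sup>2" using assms(2) by (intro norm_triangle_le add_mono)
    then show ?case by (simp add: y_simps t_simps)
  qed (simp add: y_simps t_simps)
  have y_comm: "w * x = x * w \<Longrightarrow> w * y n = y n * w" for w n
  proof (induction n)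
    case (Suc n)
    have "w * (y n * y n) = y n * y n * w" using Suc by (metis mult.assoc)
    then show ?case using Suc by (simp add: y_simps algebra_simps)
  qed (simp add: y_simps)
  have y_sa: "selfadjoint (y n)" for n
    using assms(1) by (induction n) (simp_all add: y_simps)
  have y_step: "norm (y (Suc n) - y n) \<le> t (Suc n) - t n" for n
  proof (induction n)
    case 0 then show ?case using assms(2) by (simp add: y_simps t_simps)
  next
    case (Suc n)
    \<comment> \<open>Every iterate commutes with whatever commutes with \<open>x\<close>, so
      consecutive iterates commute and the difference of squares factors; for \<open>t\<close> the
      same factorisation is an equation.\<close>
    have "y n * y (Suc n) = y (Suc n) * y n" using y_comm y_comm[of x] by metis
    then have "y (Suc (Suc n)) - y (Suc n) = (1/2) *\<^sub>R ((y (Suc n) + y n) * (y (Suc n) - y n))"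
      by (simp add: y_simps(2)[of "Suc n"] y_simps(2)[of n] algebra_simps)
    then have "norm (y (Suc (Suc n)) - y (Suc n)) \<le> (1/2) * (norm (y (Suc n) + y n) * norm (y (Suc n) - y n))"
      using norm_mult_ineq by simp
    also have "\<dots> \<le> (1/2) * ((t (Suc n) + t n) * (t (Suc n) - t n))"
      using Suc y_norm[of n] y_norm[of "Suc n"] t_bounds[of n] t_bounds[of "Suc n"]
        norm_triangle_ineq[of "y (Suc n)" "y n"]
      by (intro mult_left_mono mult_mono) auto
    also have "\<dots> = t (Suc (Suc n)) - t (Suc n)"
      unfolding t_simps(2)[of "Suc n"] unfolding t_simps(2)[of n]
      by (simp add: power2_eq_square field_simps)
    finally show ?case .
  qed
  have "incseq t"
    using order_trans[OF norm_ge_zero y_step] by (intro incseq_SucI) simp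
  then obtain L where "t \<longlonglongrightarrow> L" using incseq_convergent[of t 1] t_bounds by blast
  then have "summable (\<lambda>n. t (Suc n) - t n)" by (rule telescope_summable)
  then have "summable (\<lambda>n. y (Suc n) - y n)"
    by (rule summable_comparison_test'[where N = 0]) (use y_step in auto)
  then have "(\<lambda>n. \<Sum>k<n. y (Suc k) - y k) \<longlonglongrightarrow> (\<Sum>k. y (Suc k) - y k)"
    by (rule summable_LIMSEQ)
  then obtain Y where Y: "y \<longlonglongrightarrow> Y" by (auto simp: sum_lessThan_telescope y_simps(1))
  have "(\<lambda>n. y (Suc n)) \<longlonglongrightarrow> (1/2) *\<^sub>R (x + Y * Y)"
    unfolding y_simps by (intro tendsto_intros Y)
  then have YY: "Y = (1/2) *\<^sub>R (x + Y * Y)" using LIMSEQ_Suc[OF Y] LIMSEQ_unique by blast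
  then have "2 *\<^sub>R Y = x + Y * Y" by (metis scaleR_half_double scaleR_2 scaleR_right_distrib)
  then have sq: "(1 - Y) * (1 - Y) = 1 - x" by (simp add: algebra_simps scaleR_2)
  have sa: "selfadjoint (1 - Y)" by (rule sa_diff[OF sa_1 sa_limit[OF Y y_sa]])
  have "norm Y \<le> 1"
    using y_norm t_bounds order_trans by (intro LIMSEQ_le_const2[OF tendsto_norm[OF Y]]) blast
  \<comment> \<open>This bound is what later makes the root positive, by the norm criterion with
    \<open>t = 1\<close>.\<close>
  then have norm: "norm (1 - (1 - Y)) \<le> 1" by simp
  have comm: "w * (1 - Y) = (1 - Y) * w" if "w * x = x * w" for w
  proof -
    have "(\<lambda>n. w * y n) \<longlonglongrightarrow> w * Y" by (intro tendsto_intros Y)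
    moreover have "(\<lambda>n. w * y n) \<longlonglongrightarrow> Y * w" unfolding y_comm[OF that] by (intro tendsto_intros Y)
    ultimately have "w * Y = Y * w" using LIMSEQ_unique by blast
    then show ?thesis by (simp add: algebra_simps)
  qed
  show ?thesis by (rule that[OF sa sq norm comm])
qed

section \<open>Norms of commuting squares, and a point of the spectrum of maximal modulus\<close>

lemma norm_le_commuting_sum_sq:
  assumes "selfadjoint a" "selfadjoint q" "a * q = q * a"
  shows "(norm a)\<^sup>2 \<le> norm (a * a + q * q)"
proof -
  \<comment> \<open>As \<open>a\<close> and \<open>q\<close> commute,
    \<open>star u * u = a^2 + q^2\<close>, so the C*-identity computes \<open>norm u\<close>, and
    \<open>a\<close> is the real part of \<open>u\<close>. This stands in for monotonicity of the
    norm on positive elements while there is no order yet.\<close>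
  define u where "u = a + \<i> *\<^sub>C q"
  have su: "star u = a - \<i> *\<^sub>C q" using assms by (simp add: u_def star_add star_scaleC_i sa_star)
  have "star u * u = a * a + q * q"
    unfolding su unfolding u_def using assms(3)
    by (simp add: algebra_simps mult_scaleC_left mult_scaleC_right scaleC_i_i scaleC_add_right scaleC_diff_right)
  then have n: "(norm u)\<^sup>2 = norm (a * a + q * q)" using cstar_identity[of u] by simp
  have "a = (1/2) *\<^sub>R (u + star u)" unfolding su by (simp add: u_def scaleR_2[symmetric])
  then have "norm a = norm (u + star u) / 2" by simp
  then have "norm a \<le> norm u" using norm_triangle_ineq[of u "star u"] by simp
  then show ?thesis using n by (metis norm_ge_zero power_mono)
qed

text \<open>The root \<open>g\<close> of \<open>1 - d^2\<close> commutes with \<open>d\<close> and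
  \<open>g^2 + d^2 = 1\<close>, so the preceding estimate bounds \<open>g\<close>.\<close>

lemma norm_one_minus_sq:
  assumes "selfadjoint d" "norm d \<le> 1" shows "norm (1 - d * d) \<le> 1"
proof -
  have "norm (d * d) \<le> 1" using assms by (simp add: sa_norm_sq power_le_one)
  then obtain g where g: "selfadjoint g" "g * g = 1 - d * d" "d * g = g * d"
    using assms sqrt_one_minus[of "d * d"] by (metis mult.assoc sa_sq)
  then have "(norm g)\<^sup>2 \<le> norm (1::'a)" using norm_le_commuting_sum_sq[of g d] assms by simp
  then show ?thesis using g norm_one_le[where 'a='a] by (metis order_trans sa_norm_sq)
qed

lemma norm_scalar_minus_sq:
  assumes "selfadjoint d" "(norm d)\<^sup>2 \<le> t" shows "norm (t *\<^sub>R 1 - d * d) \<le> t"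
proof (cases "t = 0")
  case False
  then have t: "t > 0" using assms by (metis order_le_less zero_le_power2 order_trans)
  let ?e = "(1 / sqrt t) *\<^sub>R d"
  have "norm d \<le> sqrt t" using assms t by (simp add: real_le_rsqrt)
  then have "norm (1 - ?e * ?e) \<le> 1" using t assms by (intro norm_one_minus_sq) auto
  then have "norm (t *\<^sub>R (1 - ?e * ?e)) \<le> t" using t by simp
  also have "t *\<^sub>R (1 - ?e * ?e) = t *\<^sub>R 1 - d * d" using t by (simp add: scaleR_diff_right)
  finally show ?thesis .
qed (use assms in simp)

text \<open>An invertible \<open>1 - a^2\<close> would be bounded below by some
  \<open>1/m^2\<close>, leaving \<open>a^2\<close> at most \<open>1 - 1/m^2\<close>, against norm
  one. Without an order, this is expressed by writing \<open>1 - 1/m^2\<close> as a sum of commuting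
  squares \<open>a^2 + (d g)^2\<close>.\<close>

lemma not_invertible_one_minus_sq:
  assumes "selfadjoint a" "norm a = 1" shows "\<not> cstar_invertible (1 - a * a)"
proof
  assume inv: "cstar_invertible (1 - a * a)"
  have "norm (a * a) \<le> 1" using assms by (simp add: sa_norm_sq)
  then obtain d where d: "selfadjoint d" "d * d = 1 - a * a" "\<And>w. w * (a * a) = (a * a) * w \<Longrightarrow> w * d = d * w"
    using assms sqrt_one_minus[of "a * a"] by (metis sa_sq)
  have ad: "a * d = d * a" by (rule d(3)) (simp add: mult.assoc)
  have "cstar_invertible d" using inv d(2) invertible_commuting_factor[of d d] by simp
  then obtain f where f: "d * f = 1" "f * d = 1" by (auto simp: cstar_invertible_def)
  have sf: "selfadjoint f" using f d(1) by (rule sa_inverse)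
  have af: "a * f = f * a" using f ad by (rule inverse_commute)
  have one: "norm (1::'a) = 1"
    using norm_mult_ineq[of a 1] norm_one_le[where 'a='a] assms by simp
  have "(norm d)\<^sup>2 \<le> 1" using d assms norm_one_minus_sq[of a] by (metis dual_order.refl sa_norm_sq)
  then have nd: "norm d \<le> 1" by (simp add: power_le_one_iff abs_square_le_1)
  \<comment> \<open>\<open>f\<close> inverts \<open>d\<close>, the root of \<open>1 - a^2\<close>.
    Dividing \<open>f\<close> by its norm \<open>m\<close> makes a root \<open>g\<close> of
    \<open>1 - (f/m)^2\<close> available, and then \<open>(d g)^2 = d^2 - 1/m^2\<close>.\<close>
  define m where "m = norm f"
  have "1 \<le> norm d * norm f" using norm_mult_ineq[of d f] f one by simp
  also have "\<dots> \<le> norm f" using nd by (simp add: mult_left_le_one_le)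
  finally have m: "m \<ge> 1" by (simp add: m_def)
  define F where "F = (1/m) *\<^sub>R f"
  have F: "selfadjoint F" "norm (F * F) \<le> 1" using sf m by (simp_all add: F_def sa_norm_sq) (simp add: m_def power2_eq_square)
  obtain g where g: "selfadjoint g" "g * g = 1 - F * F" "\<And>w. w * (F * F) = (F * F) * w \<Longrightarrow> w * g = g * w"
    using F sqrt_one_minus[of "F * F"] by (metis sa_sq)
  have comm: "w * g = g * w" if "w * f = f * w" for w
  proof (rule g(3))
    have "w * (f * f) = f * f * w" using that by (metis mult.assoc)
    then show "w * (F * F) = (F * F) * w" by (simp add: F_def)
  qed
  have dg: "d * g = g * d" using comm f by simp
  have ag: "a * g = g * a" using comm af by simp
  have "(d * g) * (d * g) = d * d * (g * g)" using dg by (metis mult.assoc)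
  also have "\<dots> = d * d - (1/m^2) *\<^sub>R (d * d * (f * f))"
    unfolding g F_def by (simp add: algebra_simps power2_eq_square)
  also have "d * d * (f * f) = 1" using f by (metis mult.assoc mult_1)
  finally have "a * a + (d * g) * (d * g) = (1 - 1/m^2) *\<^sub>R 1" using d by (simp add: algebra_simps)
  moreover have "a * (d * g) = d * g * a" using ad ag by (metis mult.assoc)
  ultimately have "1 \<le> norm ((1 - 1/m^2) *\<^sub>R (1::'a))"
    using norm_le_commuting_sum_sq[of a "d * g"] assms d g dg sa_mult by (metis power_one)
  also have "\<dots> \<le> \<bar>1 - 1/m^2\<bar>" by (rule norm_scaleR_one_le)
  also have "\<dots> < 1" using m by (simp add: abs_if field_simps power2_eq_square)
     (smt (verit) m mult_le_cancel_left1)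
  finally show False by simp
qed

text \<open>Spectral reading: the two factors cannot both be invertible, so \<open>norm a\<close> or
  \<open>- norm a\<close> lies in the spectrum of \<open>a\<close>.\<close>

lemma not_invertible_norm_sq_minus_sq:
  assumes "selfadjoint a" "a \<noteq> 0"
  shows "\<not> cstar_invertible ((norm a *\<^sub>R 1 - a) * (norm a *\<^sub>R 1 + a))"
proof
  assume i: "cstar_invertible ((norm a *\<^sub>R 1 - a) * (norm a *\<^sub>R 1 + a))"
  let ?b = "(1 / norm a) *\<^sub>R a"
  have "(1 / (norm a)\<^sup>2) *\<^sub>R ((norm a *\<^sub>R 1 - a) * (norm a *\<^sub>R 1 + a)) = 1 - ?b * ?b"
    using assms(2) by (simp add: algebra_simps power2_eq_square)
  then have "cstar_invertible (1 - ?b * ?b)" using invertible_scaleR[OF i, of "1 / (norm a)\<^sup>2"] assms(2) by simp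
  then show False using not_invertible_one_minus_sq[of ?b] assms by simp
qed

text \<open>Negative \<open>c\<close> are excluded by the Neumann series. For \<open>c\<close> off
  the real axis, \<open>c - a\<close> is a factor of \<open>b^2 + (Im c)^2\<close>, which is
  invertible because squares obey the norm criterion themselves. After this, the complex spectrum is
  met only in \<open>pos_cone_invertible_add\<close>.\<close>

lemma pos_coneI_norm:
  assumes "selfadjoint a" "norm (t *\<^sub>R 1 - a) \<le> t" shows "a \<in> pos_cone"
proof -
  have "c \<in> \<real>\<^sub>\<ge>\<^sub>0" if c: "\<not> cstar_invertible (c *\<^sub>C 1 - a)" for c
  proof (rule ccontr)
    assume nc: "c \<notin> \<real>\<^sub>\<ge>\<^sub>0"
    define b where "b = Re c *\<^sub>R 1 - a"
    define k where "k = \<i> *\<^sub>C Im c *\<^sub>R (1::'a)"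
    have ck: "c *\<^sub>C 1 - a = b + k" by (subst scaleC_complex) (simp add: b_def k_def)
    show False
    proof (cases "Im c = 0")
      case True
      then have "Re c < 0" using nc by (auto simp: complex_nonneg_Reals_iff)
      then have "cstar_invertible (a + (- Re c) *\<^sub>R 1)"
        using assms(2) by (intro invertible_add_scalar[of t]) simp
      then have "cstar_invertible ((-1) *\<^sub>R (a + (- Re c) *\<^sub>R 1))" by (rule invertible_scaleR) simp
      moreover have "(-1) *\<^sub>R (a + (- Re c) *\<^sub>R 1) = b + k"
        by (simp add: b_def k_def True)
      ultimately show False using c ck by simp
    next
      case False
      have sb: "selfadjoint b" using assms by (simp add: b_def)
      have kk: "k * k = - ((Im c)\<^sup>2 *\<^sub>R 1)"
        by (simp add: k_def mult_scaleC_left mult_scaleC_right scaleC_i_i scaleC_scaleR power2_eq_square scaleC_minus_right)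
      have bk: "b * k = k * b" by (simp add: k_def mult_scaleC_left mult_scaleC_right)
      have "norm ((norm b)\<^sup>2 *\<^sub>R 1 - b * b) \<le> (norm b)\<^sup>2" using sb by (intro norm_scalar_minus_sq) auto
      then have "cstar_invertible (b * b + (Im c)\<^sup>2 *\<^sub>R 1)"
        using False by (intro invertible_add_scalar) (auto simp: add_pos_pos intro: order.strict_trans1)
      moreover have "b * b + (Im c)\<^sup>2 *\<^sub>R 1 = (b + k) * (b - k)" "(b + k) * (b - k) = (b - k) * (b + k)"
        using kk bk by (simp_all add: algebra_simps)
      ultimately have "cstar_invertible (b + k)" using invertible_commuting_factor by metis
      then show False using c ck by simp
    qed
  qed
  then show ?thesis using assms(1) by (auto simp: pos_cone_def cstar_spectrum_def)
qed

section \<open>The positive cone: closed, convex, pointed, with square roots\<close>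

lemma sa_pos_cone: "a \<in> pos_cone \<Longrightarrow> selfadjoint a" by (simp add: pos_cone_def)

lemma pos_cone_invertible_add:
  assumes "a \<in> pos_cone" "\<mu> > 0" shows "cstar_invertible (a + \<mu> *\<^sub>R 1)"
proof -
  have "complex_of_real (-\<mu>) \<notin> cstar_spectrum a"
    using assms by (auto simp: pos_cone_def complex_nonneg_Reals_iff dest!: subsetD)
  then have "cstar_invertible ((-\<mu>) *\<^sub>R 1 - a)" by (simp add: cstar_spectrum_def scaleR_scaleC)
  then have "cstar_invertible ((-1) *\<^sub>R ((-\<mu>) *\<^sub>R 1 - a))" by (rule invertible_scaleR) simp
  then show ?thesis by (simp add: add.commute)
qed

text \<open>Put \<open>b = norm a - a\<close>. If \<open>norm b > norm a\<close>, then
  \<open>norm b - b = a + (norm b - norm a)\<close> is invertible by hypothesis and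
  \<open>norm b + b = (norm b + norm a) - a\<close> by the Neumann series, which is impossible for a
  nonzero self-adjoint \<open>b\<close>.\<close>

lemma norm_le_if_invertible_add:
  assumes "selfadjoint a" "\<And>\<mu>. \<mu> > 0 \<Longrightarrow> cstar_invertible (a + \<mu> *\<^sub>R 1)"
  shows "norm (norm a *\<^sub>R 1 - a) \<le> norm a"
proof (rule ccontr)
  define s where "s = norm a"
  define b where "b = s *\<^sub>R 1 - a"
  assume "\<not> norm (norm a *\<^sub>R 1 - a) \<le> norm a"
  then have s: "norm b > s" by (simp add: b_def s_def)
  have s0: "s \<ge> 0" by (simp add: s_def)
  have "norm ((0::real) *\<^sub>R 1 - (- a)) < 0 + (norm b + s)"
    using s0 le_less_trans[OF s0 s] by (simp add: s_def)
  then have "cstar_invertible (- a + (norm b + s) *\<^sub>R 1)" by (rule invertible_add_scalar)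
  moreover have "- a + (norm b + s) *\<^sub>R 1 = norm b *\<^sub>R 1 + b" by (simp add: b_def algebra_simps)
  moreover have "cstar_invertible (a + (norm b - s) *\<^sub>R 1)" using assms(2) s by simp
  moreover have "a + (norm b - s) *\<^sub>R 1 = norm b *\<^sub>R 1 - b" by (simp add: b_def algebra_simps)
  ultimately have "cstar_invertible ((norm b *\<^sub>R 1 - b) * (norm b *\<^sub>R 1 + b))"
    using invertible_mult by metis
  moreover have "selfadjoint b" using assms by (simp add: b_def)
  moreover have "b \<noteq> 0" using s s0 by fastforce
  ultimately show False using not_invertible_norm_sq_minus_sq by blast
qed

lemma pos_coneI_invertible:
  assumes "selfadjoint a" "\<And>\<mu>. \<mu> > 0 \<Longrightarrow> cstar_invertible (a + \<mu> *\<^sub>R 1)" shows "a \<in> pos_cone"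
  using assms(1) norm_le_if_invertible_add[OF assms] by (rule pos_coneI_norm)

lemma pos_cone_norm:
  assumes "a \<in> pos_cone" "norm a \<le> t" shows "norm (t *\<^sub>R 1 - a) \<le> t"
proof -
  define b where "b = norm a *\<^sub>R 1 - a"
  have "norm b \<le> norm a" unfolding b_def
    using assms by (intro norm_le_if_invertible_add pos_cone_invertible_add sa_pos_cone)
  moreover have "t *\<^sub>R 1 - a = (t - norm a) *\<^sub>R 1 + b" by (simp add: b_def algebra_simps)
  moreover have "norm ((t - norm a) *\<^sub>R (1::'a)) \<le> t - norm a"
    using norm_scaleR_one_le[of "t - norm a"] assms by simp
  ultimately show ?thesis using norm_triangle_le[of "(t - norm a) *\<^sub>R 1" b t] by simp
qed

lemma pos_cone_sq: "selfadjoint d \<Longrightarrow> d * d \<in> pos_cone"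
  by (rule pos_coneI_norm[of _ "(norm d)\<^sup>2"]) (auto intro: norm_scalar_minus_sq)

lemma pos_cone_0 [simp]: "0 \<in> pos_cone" using pos_cone_sq[of 0] by simp
lemma pos_cone_1 [simp]: "1 \<in> pos_cone" using pos_cone_sq[of 1] by simp

text \<open>The norm criterion reduces this to the triangle inequality.\<close>

lemma pos_cone_add [intro]:
  assumes "a \<in> pos_cone" "b \<in> pos_cone" shows "a + b \<in> pos_cone"
proof (rule pos_coneI_norm)
  have "(norm a + norm b) *\<^sub>R 1 - (a + b) = (norm a *\<^sub>R 1 - a) + (norm b *\<^sub>R 1 - b)" by (simp add: algebra_simps)
  then show "norm ((norm a + norm b) *\<^sub>R 1 - (a + b)) \<le> norm a + norm b"
    using pos_cone_norm[OF assms(1)] pos_cone_norm[OF assms(2)] by (metis add_mono norm_triangle_le order_refl)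
qed (use assms sa_pos_cone in auto)

lemma pos_cone_scaleR [intro]:
  assumes "a \<in> pos_cone" "r \<ge> 0" shows "r *\<^sub>R a \<in> pos_cone"
proof (rule pos_coneI_norm)
  have "norm (r *\<^sub>R (norm a *\<^sub>R 1 - a)) \<le> r * norm a"
    using pos_cone_norm[OF assms(1)] assms(2) by (simp add: mult_left_mono)
  then show "norm ((r * norm a) *\<^sub>R 1 - r *\<^sub>R a) \<le> r * norm a" by (simp add: scaleR_diff_right)
qed (use assms sa_pos_cone in auto)

lemma pos_cone_limit:
  assumes "X \<longlonglongrightarrow> a" "\<And>n. X n \<in> pos_cone" shows "a \<in> pos_cone"
proof -
  obtain B where B: "norm (X n) \<le> B" for n
    using convergent_imp_Bseq[of X] assms(1) by (auto simp: Bseq_def convergent_def)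
  have "(\<lambda>n. norm (B *\<^sub>R 1 - X n)) \<longlonglongrightarrow> norm (B *\<^sub>R 1 - a)" by (intro tendsto_intros assms)
  then have "norm (B *\<^sub>R 1 - a) \<le> B"
    using LIMSEQ_le_const2 pos_cone_norm[OF assms(2) B] by blast
  then show ?thesis using assms sa_limit sa_pos_cone by (intro pos_coneI_norm) blast+
qed

lemma pos_cone_root:
  assumes "a \<in> pos_cone"
  obtains d where "d \<in> pos_cone" "d * d = a" "\<And>w. w * a = a * w \<Longrightarrow> w * d = d * w"
proof (cases "a = 0")
  case True
  then show ?thesis using that[of 0] by simp
next
  case False
  define s where "s = norm a"
  have s: "s > 0" using False by (simp add: s_def)
  \<comment> \<open>After scaling to norm one the criterion gives \<open>norm x \<le> 1\<close>, so
    \<open>1 - x = a/s\<close> has a root.\<close>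
  define x where "x = 1 - (1/s) *\<^sub>R a"
  have "(1/s) *\<^sub>R (s *\<^sub>R 1 - a) = x" using s by (simp add: x_def scaleR_diff_right)
  then have "norm x \<le> 1" using pos_cone_norm[OF assms, of s] s by (metis dual_order.refl norm_scaleR s_def
      abs_of_pos divide_pos_pos mult_left_mono nonzero_eq_divide_eq less_numeral_extra(1) less_irrefl less_imp_le)
  moreover have "selfadjoint x" using assms by (simp add: x_def sa_pos_cone)
  ultimately obtain d where d: "selfadjoint d" "d * d = 1 - x" "norm (1 - d) \<le> 1"
    "\<And>w. w * x = x * w \<Longrightarrow> w * d = d * w"
    using sqrt_one_minus by blast
  have "d \<in> pos_cone" using d(1,3) by (intro pos_coneI_norm[of _ 1]) simp_all
  then have "sqrt s *\<^sub>R d \<in> pos_cone" using s by (intro pos_cone_scaleR) auto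
  moreover have "(sqrt s *\<^sub>R d) * (sqrt s *\<^sub>R d) = a" using d(2) s by (simp add: x_def)
  moreover have "w * (sqrt s *\<^sub>R d) = (sqrt s *\<^sub>R d) * w" if "w * a = a * w" for w
    using that d(4)[of w] by (simp add: x_def algebra_simps)
  ultimately show ?thesis using that by blast
qed

text \<open>For \<open>a \<noteq> 0\<close>, positivity of \<open>a\<close> and \<open>- a\<close>
  would make \<open>norm a + a\<close> and \<open>norm a - a\<close> invertible at once.\<close>

lemma pos_cone_antisym:
  assumes "a \<in> pos_cone" "- a \<in> pos_cone" shows "a = 0"
proof (rule ccontr)
  assume a: "a \<noteq> 0"
  have "cstar_invertible (a + norm a *\<^sub>R 1)" "cstar_invertible (- a + norm a *\<^sub>R 1)"
    using pos_cone_invertible_add[OF assms(1)] pos_cone_invertible_add[OF assms(2)] a by simp_all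
  then have "cstar_invertible ((- a + norm a *\<^sub>R 1) * (a + norm a *\<^sub>R 1))" using invertible_mult by blast
  then show False using not_invertible_norm_sq_minus_sq[of a] a assms(1) by (simp add: sa_pos_cone add.commute)
qed

text \<open>Nonzero spectral values of \<open>x y\<close> and \<open>y x\<close> agree: if
  \<open>u\<close> inverts \<open>x y + \<mu>\<close>, then \<open>(1 - y u x)/\<mu>\<close> inverts
  \<open>y x + \<mu>\<close>.\<close>

lemma invertible_swap:
  assumes "cstar_invertible (x * y + \<mu> *\<^sub>R 1)" "\<mu> \<noteq> 0" shows "cstar_invertible (y * x + \<mu> *\<^sub>R 1)"
proof -
  obtain u where u: "(x * y + \<mu> *\<^sub>R 1) * u = 1" "u * (x * y + \<mu> *\<^sub>R 1) = 1"
    using assms(1) by (auto simp: cstar_invertible_def)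
  have 1: "x * (y * u) = 1 - \<mu> *\<^sub>R u" "u * (x * y) = 1 - \<mu> *\<^sub>R u"
    using u by (simp_all add: algebra_simps)
  have "y * x * (y * u * x) = y * (x * (y * u)) * x" by (simp add: mult.assoc)
  also have "\<dots> = y * x - \<mu> *\<^sub>R (y * u * x)" unfolding 1 by (simp add: algebra_simps)
  finally have 2: "(y * x + \<mu> *\<^sub>R 1) * (1 - y * u * x) = \<mu> *\<^sub>R 1" by (simp add: algebra_simps)
  have "y * u * x * (y * x) = y * (u * (x * y)) * x" by (simp add: mult.assoc)
  also have "\<dots> = y * x - \<mu> *\<^sub>R (y * u * x)" unfolding 1 by (simp add: algebra_simps)
  finally have 3: "(1 - y * u * x) * (y * x + \<mu> *\<^sub>R 1) = \<mu> *\<^sub>R 1" by (simp add: algebra_simps)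
  show ?thesis unfolding cstar_invertible_def
    by (rule exI[of _ "(1/\<mu>) *\<^sub>R (1 - y * u * x)"])
      (use 2 3 assms(2) in \<open>simp only: mult_scaleR_left mult_scaleR_right, simp\<close>)
qed

section \<open>The order, inverses and geometric means\<close>

text \<open>With \<open>a\<close> the absolute value of \<open>b\<close>, \<open>k = a - b\<close>
  is twice the negative part of \<open>b\<close>. For \<open>y = x k\<close>,
  \<open>star y * y = k b k\<close> is negative, whereas \<open>star y * y + y * star y\<close> is
  positive as a sum of squares; so \<open>y * star y\<close> is positive and, exchanging the
  factors, so is \<open>star y * y\<close>. Hence it is zero, which forces
  \<open>k = 0\<close>.\<close>

lemma pos_cone_star_mult: "star x * x \<in> pos_cone"
proof -
  define b where "b = star x * x"
  have b: "selfadjoint b" by (simp add: b_def selfadjoint_def star_mult star_star)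
  obtain a where a: "a \<in> pos_cone" "a * a = b * b" "\<And>w. w * (b * b) = b * b * w \<Longrightarrow> w * a = a * w"
    using pos_cone_root[OF pos_cone_sq[OF b]] by blast
  \<comment> \<open>The root of \<open>a\<close> exhibits \<open>k a k\<close> as the square of
    \<open>k r\<close>.\<close>
  obtain r where r: "r \<in> pos_cone" "r * r = a" "\<And>w. w * a = a * w \<Longrightarrow> w * r = r * w"
    using pos_cone_root[OF a(1)] by blast
  have ab: "b * a = a * b" by (rule a(3)) (simp add: mult.assoc)
  have sa: "selfadjoint a" "selfadjoint r" using a(1) r(1) by (simp_all add: sa_pos_cone)
  define k where "k = a - b"
  have k: "selfadjoint k" using b sa by (simp add: k_def)
  have kb: "k * b = - (k * a)" using ab a(2) by (simp add: k_def algebra_simps)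
  have kr: "k * r = r * k" by (rule r(3)) (use ab in \<open>simp add: k_def algebra_simps\<close>)
  have skr: "selfadjoint (k * r)" using k sa kr by (simp add: sa_mult)
  define y where "y = x * k"
  have "star y * y = k * b * k" using k by (simp add: y_def b_def star_mult sa_star mult.assoc)
  also have "\<dots> = - (k * (r * r) * k)" using kb r(2) by simp
  also have "k * (r * r) * k = (k * r) * (k * r)" using kr by (metis mult.assoc)
  finally have yy: "star y * y = - ((k * r) * (k * r))" .
  then have neg: "- (star y * y) \<in> pos_cone" using pos_cone_sq[OF skr] by simp
  \<comment> \<open>\<open>h\<close> and \<open>g\<close> are the real and imaginary parts of
    \<open>y\<close> up to the factors \<open>2\<close> and \<open>-2\<close>.\<close>
  define h where "h = y + star y"
  define g where "g = \<i> *\<^sub>C (y - star y)"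
  have "selfadjoint h" by (simp add: h_def selfadjoint_def star_add star_star add.commute)
  moreover have "selfadjoint g"
    by (simp add: g_def selfadjoint_def star_scaleC_i star_star scaleC_diff_right)
  moreover have "y * star y = (1/2) *\<^sub>R (h * h + g * g) + - (star y * y)"
  proof -
    have "g * g = - ((y - star y) * (y - star y))"
      by (simp add: g_def mult_scaleC_left mult_scaleC_right scaleC_i_i)
    then have "h * h + g * g = 2 *\<^sub>R (y * star y + star y * y)" by (simp add: h_def algebra_simps scaleR_2)
    then show ?thesis by simp
  qed
  ultimately have ys: "y * star y \<in> pos_cone" using neg
    by (simp only:) (intro pos_cone_add pos_cone_scaleR pos_cone_sq, auto)
  have "star y * y \<in> pos_cone"
  proof (rule pos_coneI_invertible)
    show "selfadjoint (star y * y)" by (simp add: selfadjoint_def star_mult star_star)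
    show "cstar_invertible (star y * y + \<mu> *\<^sub>R 1)" if "\<mu> > 0" for \<mu>
      using invertible_swap[OF pos_cone_invertible_add[OF ys that]] that by simp
  qed
  then have "star y * y = 0" using neg pos_cone_antisym by blast
  then have "(k * r) * (k * r) = 0" using yy by simp
  then have "k * r = 0" using sa_norm_sq[OF skr] by simp
  then have "k * a = 0" using r(2) by (metis mult.assoc mult_zero_left)
  moreover from this have "k * b = 0" using kb by simp
  moreover have "k * k = k * a - k * b" by (simp add: k_def algebra_simps)
  ultimately have "k * k = 0" by simp
  then have "k = 0" using sa_norm_sq[OF k] by simp
  then show ?thesis using a(1) by (simp add: k_def b_def)
qed

lemma pos_cone_conj:
  assumes "selfadjoint c" "p \<in> pos_cone" shows "c * p * c \<in> pos_cone"
proof -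
  obtain d where d: "d \<in> pos_cone" "d * d = p" using pos_cone_root[OF assms(2)] by metis
  then show ?thesis using pos_cone_star_mult[of "d * c"] assms
    by (auto simp: star_mult sa_star sa_pos_cone mult.assoc)
qed

lemma pos_cone_sum_eq_0:
  assumes "a \<in> pos_cone" "b \<in> pos_cone" "a + b = 0" shows "a = 0"
  using assms pos_cone_antisym by (metis add.inverse_unique)

text \<open>Two positive roots need not visibly commute, so each is compared with the root
  \<open>s\<close> that commutes with everything commuting with its square. For
  \<open>w = y - s\<close>, the positive elements \<open>w y w\<close> and \<open>w s w\<close> have
  sum zero, hence vanish, and so does their difference \<open>w^3\<close>.\<close>

lemma pos_cone_root_unique:
  assumes "y \<in> pos_cone" "z \<in> pos_cone" "y * y = z * z" shows "y = z"
proof -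
  have main: "y = s" if y: "y \<in> pos_cone" "y * y = x" and s: "s \<in> pos_cone" "s * s = x"
    "\<And>w. w * x = x * w \<Longrightarrow> w * s = s * w" for x y s :: 'a
  proof -
    have ys: "y * s = s * y" by (rule s(3)) (simp add: y(2)[symmetric] mult.assoc)
    define w where "w = y - s"
    have w: "selfadjoint w" using y(1) s(1) by (simp add: w_def sa_pos_cone)
    have 1: "w * (y + s) = 0" using y(2) s(2) ys by (simp add: w_def algebra_simps)
    have "w * y * w + w * s * w = w * (y + s) * w" by (simp add: algebra_simps)
    then have sum: "w * y * w + w * s * w = 0" using 1 by simp
    then have "w * y * w = 0" "w * s * w = 0"
      using pos_cone_conj[OF w y(1)] pos_cone_conj[OF w s(1)] pos_cone_sum_eq_0 by (metis add.commute)+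
    moreover have "w * w * w = w * y * w - w * s * w" by (simp add: w_def algebra_simps)
    ultimately have "w * w * w = 0" by simp
    then have "(w * w) * (w * w) = 0" by (metis mult.assoc mult_zero_right)
    then have "w * w = 0" using sa_norm_sq[of "w * w"] w by simp
    then have "w = 0" using sa_norm_sq[OF w] by simp
    then show ?thesis by (simp add: w_def)
  qed
  obtain s where "s \<in> pos_cone" "s * s = y * y" "\<And>w. w * (y * y) = y * y * w \<Longrightarrow> w * s = s * w"
    using pos_cone_root[OF pos_cone_sq] assms sa_pos_cone by metis
  then show ?thesis using main[of y "y * y" s] main[of z "y * y" s] assms by metis
qed

lemma cstar_sqrt_eq: "y \<in> pos_cone \<Longrightarrow> y * y = x \<Longrightarrow> cstar_sqrt x = y"
  unfolding cstar_sqrt_def by (rule the_equality) (auto intro: pos_cone_root_unique)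

section \<open>The order on self-adjoint elements\<close>

lemma cle_sa: "x \<preceq> y \<Longrightarrow> selfadjoint x" "x \<preceq> y \<Longrightarrow> selfadjoint y" "x \<preceq> y \<Longrightarrow> y - x \<in> pos_cone"
  by (simp_all add: cstar_le_def)

lemma cleI: "selfadjoint x \<Longrightarrow> selfadjoint y \<Longrightarrow> y - x \<in> pos_cone \<Longrightarrow> x \<preceq> y"
  by (simp add: cstar_le_def)

lemma cle_0_iff [simp]: "0 \<preceq> x \<longleftrightarrow> x \<in> pos_cone"
  by (auto simp: cstar_le_def sa_pos_cone)

lemma cle_refl [simp]: "x \<preceq> x \<longleftrightarrow> selfadjoint x" by (simp add: cstar_le_def)

lemma cle_trans [trans]: "x \<preceq> y \<Longrightarrow> y \<preceq> z \<Longrightarrow> x \<preceq> z"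
  using pos_cone_add[of "z - y" "y - x"] by (simp add: cstar_le_def)

lemma cle_antisym: "x \<preceq> y \<Longrightarrow> y \<preceq> x \<Longrightarrow> x = y"
  using pos_cone_antisym[of "y - x"] by (simp add: cstar_le_def)

lemma cle_add_right: "x \<preceq> y \<Longrightarrow> selfadjoint z \<Longrightarrow> x + z \<preceq> y + z"
  by (simp add: cstar_le_def)

lemma cle_add_left: "x \<preceq> y \<Longrightarrow> selfadjoint z \<Longrightarrow> z + x \<preceq> z + y"
  by (simp add: cstar_le_def)

lemma cle_minus: "x \<preceq> y \<Longrightarrow> - y \<preceq> - x"
  by (simp add: cstar_le_def)

lemma cle_scaleR: "x \<preceq> y \<Longrightarrow> r \<ge> 0 \<Longrightarrow> r *\<^sub>R x \<preceq> r *\<^sub>R y"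
  by (auto simp: cstar_le_def scaleR_diff_right[symmetric])

lemma cle_scaleR_left: "p \<in> pos_cone \<Longrightarrow> r \<le> s \<Longrightarrow> r *\<^sub>R p \<preceq> s *\<^sub>R p"
  by (auto simp: cstar_le_def sa_pos_cone scaleR_diff_left[symmetric])

lemma cle_conj: "x \<preceq> y \<Longrightarrow> selfadjoint c \<Longrightarrow> c * x * c \<preceq> c * y * c"
  using pos_cone_conj[of c "y - x"] unfolding cstar_le_def
  by (simp only: sa_conj right_diff_distrib left_diff_distrib)

lemma pos_cone_cle: "p \<in> pos_cone \<Longrightarrow> p \<preceq> q \<Longrightarrow> q \<in> pos_cone"
  using cle_trans[of 0 p q] by simp

lemma cle_norm: "selfadjoint a \<Longrightarrow> norm a \<le> t \<Longrightarrow> a \<preceq> t *\<^sub>R 1"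
  by (rule cleI, simp, simp, rule pos_coneI_norm[of _ t]) auto

lemma cle_minus_norm: "selfadjoint a \<Longrightarrow> norm a \<le> t \<Longrightarrow> (- t) *\<^sub>R 1 \<preceq> a"
  using cle_minus[OF cle_norm[of "- a" t]] by simp

lemma norm_le_of_cle:
  assumes "a \<preceq> t *\<^sub>R 1" "(- t) *\<^sub>R 1 \<preceq> a" "t \<ge> 0" shows "norm a \<le> t"
proof (rule ccontr)
  assume n: "\<not> norm a \<le> t"
  have "cstar_invertible (t *\<^sub>R 1 - a + (norm a - t) *\<^sub>R 1)"
    using assms n by (intro pos_cone_invertible_add cle_sa) auto
  moreover have "t *\<^sub>R 1 - a + (norm a - t) *\<^sub>R 1 = norm a *\<^sub>R 1 - a" by (simp add: algebra_simps)
  moreover have "cstar_invertible (a - (- t) *\<^sub>R 1 + (norm a - t) *\<^sub>R 1)"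
    using assms n by (intro pos_cone_invertible_add cle_sa) auto
  moreover have "a - (- t) *\<^sub>R 1 + (norm a - t) *\<^sub>R 1 = norm a *\<^sub>R 1 + a" by (simp add: algebra_simps)
  ultimately have "cstar_invertible ((norm a *\<^sub>R 1 - a) * (norm a *\<^sub>R 1 + a))"
    using invertible_mult by metis
  moreover have "a \<noteq> 0" using n assms(3) by auto
  ultimately show False using not_invertible_norm_sq_minus_sq[of a] cle_sa[OF assms(1)] by blast
qed

lemma cle_limit:
  assumes "X \<longlonglongrightarrow> a" "Y \<longlonglongrightarrow> b" "\<And>n. X n \<preceq> Y n" shows "a \<preceq> b"
proof (rule cleI)
  show "selfadjoint a" "selfadjoint b" using assms by (auto intro: sa_limit cle_sa)
  show "b - a \<in> pos_cone"
    using tendsto_diff[OF assms(2,1)] cle_sa(3)[OF assms(3)] by (rule pos_cone_limit)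
qed

section \<open>Invertible positive elements and their reflections\<close>

definition ppos :: "'a::unital_cstar_algebra set"
  where "ppos = {x \<in> pos_cone. cstar_invertible x}"

definition cinv :: "'a::unital_cstar_algebra \<Rightarrow> 'a"
  where "cinv x = (SOME y. x * y = 1 \<and> y * x = 1)"

lemma pposI: "x \<in> pos_cone \<Longrightarrow> cstar_invertible x \<Longrightarrow> x \<in> ppos"
  by (simp add: ppos_def)

lemma ppos_invertible: "x \<in> ppos \<Longrightarrow> cstar_invertible x"
  by (simp add: ppos_def)

lemma ppos_pos [simp]: "x \<in> ppos \<Longrightarrow> x \<in> pos_cone"
  unfolding ppos_def by blast

lemma ppos_sa [simp]: "x \<in> ppos \<Longrightarrow> selfadjoint x"
  by (simp add: sa_pos_cone)

lemma cinv: assumes "x \<in> ppos" shows "x * cinv x = 1" "cinv x * x = 1"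
proof -
  have "\<exists>y. x * y = 1 \<and> y * x = 1" using ppos_invertible[OF assms] by (simp add: cstar_invertible_def)
  from someI_ex[OF this] show "x * cinv x = 1" "cinv x * x = 1" by (auto simp: cinv_def)
qed

lemma cinv_cancel:
  assumes "x \<in> ppos"
  shows "x * (cinv x * z) = z" "cinv x * (x * z) = z"
  using cinv[OF assms] by (simp_all add: mult.assoc[symmetric])

lemma cinv_eqI: assumes "x \<in> ppos" "x * y = 1" shows "cinv x = y"
  using cinv_cancel(2)[OF assms(1), of y] assms(2) by simp

lemma ppos_1 [simp]: "1 \<in> ppos"
  by (rule pposI) (auto simp: cstar_invertible_def)

lemma cinv_1 [simp]: "cinv 1 = 1"
  by (rule cinv_eqI) auto

lemma ppos_cinv [simp]: assumes "x \<in> ppos" shows "cinv x \<in> ppos"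
proof -
  have s: "selfadjoint (cinv x)" using sa_inverse[OF cinv[OF assms]] assms by simp
  have "cinv x * x * cinv x \<in> pos_cone" using s assms by (intro pos_cone_conj) auto
  then have "cinv x \<in> pos_cone" using cinv[OF assms] by simp
  then show ?thesis using cinv[OF assms] by (intro pposI) (auto simp: cstar_invertible_def)
qed

lemma cinv_cinv [simp]: "x \<in> ppos \<Longrightarrow> cinv (cinv x) = x"
  by (intro cinv_eqI) (simp_all add: cinv)

lemma ppos_scaleR [simp]: "x \<in> ppos \<Longrightarrow> r > 0 \<Longrightarrow> r *\<^sub>R x \<in> ppos"
  by (rule pposI) (auto intro!: pos_cone_scaleR invertible_scaleR dest: ppos_invertible)

lemma cinv_scaleR: "x \<in> ppos \<Longrightarrow> r > 0 \<Longrightarrow> cinv (r *\<^sub>R x) = (1/r) *\<^sub>R cinv x"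
  by (intro cinv_eqI) (auto simp: cinv)

lemma ppos_conj [simp]: "c \<in> ppos \<Longrightarrow> x \<in> ppos \<Longrightarrow> c * x * c \<in> ppos"
  by (rule pposI) (auto intro!: pos_cone_conj invertible_mult dest: ppos_invertible)

lemma ppos_conj_right [simp]: "c \<in> ppos \<Longrightarrow> x \<in> ppos \<Longrightarrow> c * (x * c) \<in> ppos"
  using ppos_conj[of c x] by (simp only: mult.assoc)

lemma ppos_sq [simp]: "c \<in> ppos \<Longrightarrow> c * c \<in> ppos"
  using ppos_conj[of c 1] by simp

lemma cinv_conj: "c \<in> ppos \<Longrightarrow> x \<in> ppos \<Longrightarrow> cinv (c * x * c) = cinv c * cinv x * cinv c"
  by (intro cinv_eqI) (auto simp: mult.assoc cinv cinv_cancel)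

lemma ppos_root:
  assumes "x \<in> ppos" obtains r where "r \<in> ppos" "r * r = x"
proof -
  obtain r where r: "r \<in> pos_cone" "r * r = x" using pos_cone_root[OF ppos_pos[OF assms]] by metis
  then have "cstar_invertible r"
    using ppos_invertible[OF assms] invertible_commuting_factor[of r r] by simp
  then show ?thesis using that r pposI by blast
qed

text \<open>An order description of the interior of the cone, in a form that \<open>\<phi>\<close>
  can transport. Forward direction: conjugating \<open>cinv x \<preceq> m\<close> by the root of
  \<open>x\<close> gives \<open>1 \<preceq> m x\<close>.\<close>

lemma ppos_iff: "x \<in> ppos \<longleftrightarrow> (\<exists>\<delta>>0. \<delta> *\<^sub>R 1 \<preceq> x)"
proof
  assume x: "x \<in> ppos"
  obtain r where r: "r \<in> ppos" "r * r = x" using ppos_root x by blast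
  define m where "m = norm (cinv x) + 1"
  have m: "m > 0" by (simp add: m_def add_nonneg_pos)
  have "cinv x \<preceq> m *\<^sub>R 1" using x by (intro cle_norm) (auto simp: m_def)
  then have "r * cinv x * r \<preceq> r * (m *\<^sub>R 1) * r" using r by (intro cle_conj) auto
  moreover have "r * cinv x * r = 1"
  proof -
    have "r * cinv x = cinv x * r"
      by (rule inverse_commute[of x]) (use r x cinv in \<open>auto simp: mult.assoc\<close>)
    then show ?thesis using cinv[OF x] r by (simp add: mult.assoc)
  qed
  ultimately have "1 \<preceq> m *\<^sub>R x" using r by simp
  then have "(1/m) *\<^sub>R 1 \<preceq> (1/m) *\<^sub>R m *\<^sub>R x" using m by (intro cle_scaleR) auto
  then show "\<exists>\<delta>>0. \<delta> *\<^sub>R 1 \<preceq> x" using m by (intro exI[of _ "1/m"]) auto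
next
  assume "\<exists>\<delta>>0. \<delta> *\<^sub>R 1 \<preceq> x"
  then obtain \<delta> where d: "\<delta> > 0" "\<delta> *\<^sub>R 1 \<preceq> x" by blast
  have "cstar_invertible (x - \<delta> *\<^sub>R 1 + \<delta> *\<^sub>R 1)" using d cle_sa by (intro pos_cone_invertible_add) auto
  moreover have "x \<in> pos_cone" using d pos_cone_cle[of "\<delta> *\<^sub>R 1" x] by auto
  ultimately show "x \<in> ppos" by (simp add: pposI)
qed

lemma ppos_cle: "x \<in> ppos \<Longrightarrow> x \<preceq> y \<Longrightarrow> y \<in> ppos"
  unfolding ppos_iff using cle_trans by blast

lemma root_conj_cinv:
  assumes "r \<in> ppos" shows "r * cinv (r * r) * r = 1"
  using cinv_conj[OF assms ppos_1] assms by (simp add: mult.assoc cinv cinv_cancel)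

text \<open>Conjugation by the inverse root of \<open>b\<close> reduces the claim to
  \<open>u \<preceq> 1\<close>, and conjugating this by the root of \<open>cinv u\<close> gives
  \<open>1 \<preceq> cinv u\<close>.\<close>

lemma cinv_antimono:
  assumes "a \<in> ppos" "b \<in> ppos" "a \<preceq> b" shows "cinv b \<preceq> cinv a"
proof -
  obtain r where r: "r \<in> ppos" "r * r = b" using ppos_root assms by blast
  define s where "s = cinv r"
  have s: "s \<in> ppos" using r by (simp add: s_def)
  define u where "u = s * a * s"
  have u: "u \<in> ppos" using s assms by (simp add: u_def)
  have "u \<preceq> s * b * s" unfolding u_def using s assms by (intro cle_conj) auto
  also have "s * b * s = 1" using r by (simp add: s_def r(2)[symmetric] mult.assoc cinv cinv_cancel)
  finally have u1: "u \<preceq> 1" .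
  obtain v where v: "v \<in> ppos" "v * v = cinv u" using ppos_root[of "cinv u"] u by auto
  have "v * u * v \<preceq> v * 1 * v" using v u1 by (intro cle_conj) auto
  moreover have "v * u * v = 1" using root_conj_cinv[OF v(1)] v u by simp
  ultimately have "1 \<preceq> cinv u" using v by simp
  then have "s * 1 * s \<preceq> s * cinv u * s" using s by (intro cle_conj) auto
  moreover have "cinv b = s * s" using cinv_conj[of r 1] r by (simp add: s_def)
  moreover have "s * cinv u * s = cinv a"
    unfolding u_def using cinv_conj[OF s assms(1)] r by (simp add: s_def mult.assoc cinv cinv_cancel)
  ultimately show ?thesis by simp
qed

text \<open>Conjugation by the root of \<open>u\<close> gives \<open>u^2 \<preceq> T\<close>, and
  the C*-identity takes the root of the norm. The passage from \<open>T\<close> to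
  \<open>sqrt T\<close> is the source of every halving of distances below.\<close>

lemma cle_sqrt_of_cle_cinv:
  assumes "u \<in> ppos" "T > 0" "u \<preceq> T *\<^sub>R cinv u" shows "u \<preceq> sqrt T *\<^sub>R 1"
proof -
  obtain v where v: "v \<in> ppos" "v * v = u" using ppos_root assms by blast
  have "v * u * v \<preceq> v * (T *\<^sub>R cinv u) * v" using v assms by (intro cle_conj) auto
  moreover have "v * u * v = u * u" using v by (metis mult.assoc)
  moreover have "v * cinv u * v = 1" using root_conj_cinv[OF v(1)] v(2) by simp
  moreover have "v * (T *\<^sub>R cinv u) * v = T *\<^sub>R (v * cinv u * v)" by simp
  ultimately have le: "u * u \<preceq> T *\<^sub>R 1" by (simp only:)
  moreover have "(- T) *\<^sub>R 1 \<preceq> u * u"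
  proof -
    have "(- T) *\<^sub>R 1 \<preceq> (0::real) *\<^sub>R (1::'a)" using assms by (intro cle_scaleR_left) auto
    also have "0 *\<^sub>R (1::'a) \<preceq> u * u" using assms by simp
    finally show ?thesis .
  qed
  ultimately have "norm (u * u) \<le> T" using assms by (intro norm_le_of_cle) auto
  then have "(norm u)\<^sup>2 \<le> T" using assms by (simp add: sa_norm_sq)
  then show ?thesis using assms by (intro cle_norm) (auto simp: real_le_rsqrt)
qed

text \<open>The geodesic symmetry at \<open>c\<close>. The equation \<open>refl_at c a = b\<close>
  says that \<open>c\<close> is the geometric mean of \<open>a\<close> and \<open>b\<close>, so
  midpoints are handled without a formula for them.\<close>

definition refl_at :: "'a::unital_cstar_algebra \<Rightarrow> 'a \<Rightarrow> 'a"
  where "refl_at c x = c * cinv x * c"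

lemma refl_at_ppos [simp]: "c \<in> ppos \<Longrightarrow> x \<in> ppos \<Longrightarrow> refl_at c x \<in> ppos"
  by (simp add: refl_at_def)

lemma refl_at_refl_at [simp]:
  assumes "c \<in> ppos" "x \<in> ppos" shows "refl_at c (refl_at c x) = x"
proof -
  have "cinv (c * cinv x * c) = cinv c * x * cinv c" using cinv_conj[of c "cinv x"] assms by simp
  then show ?thesis using assms by (simp add: refl_at_def) (simp add: mult.assoc cinv cinv_cancel)
qed

lemma refl_at_self [simp]: "c \<in> ppos \<Longrightarrow> refl_at c c = c"
  by (simp add: refl_at_def cinv)

lemma refl_at_scaleR: "c \<in> ppos \<Longrightarrow> x \<in> ppos \<Longrightarrow> r > 0 \<Longrightarrow> refl_at c (r *\<^sub>R x) = (1/r) *\<^sub>R refl_at c x"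
  by (simp add: refl_at_def cinv_scaleR)

lemma refl_at_antimono:
  assumes "c \<in> ppos" "x \<in> ppos" "y \<in> ppos" "t > 0" "x \<preceq> t *\<^sub>R y"
  shows "refl_at c y \<preceq> t *\<^sub>R refl_at c x"
proof -
  have "refl_at c (t *\<^sub>R y) \<preceq> refl_at c x"
    unfolding refl_at_def using assms by (intro cle_conj cinv_antimono) auto
  then have "t *\<^sub>R refl_at c (t *\<^sub>R y) \<preceq> t *\<^sub>R refl_at c x" using assms by (intro cle_scaleR) auto
  then show ?thesis using assms by (simp add: refl_at_scaleR)
qed

text \<open>Reflections are isometries of the Thompson metric that exchange its two one-sided
  bounds.\<close>

lemma refl_at_antimono_iff:
  assumes "c \<in> ppos" "x \<in> ppos" "y \<in> ppos" "t > 0"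
  shows "refl_at c y \<preceq> t *\<^sub>R refl_at c x \<longleftrightarrow> x \<preceq> t *\<^sub>R y"
  using refl_at_antimono[OF assms] refl_at_antimono[of c "refl_at c y" "refl_at c x" t] assms by auto

lemma conj_root_refl_at:
  assumes "r \<in> ppos" "x \<in> ppos"
  shows "cinv r * refl_at (r * r) x * cinv r = cinv (cinv r * x * cinv r)"
proof -
  have "cinv (cinv r * x * cinv r) = r * cinv x * r" using cinv_conj[of "cinv r" x] assms by simp
  then show ?thesis using assms by (simp add: refl_at_def mult.assoc cinv cinv_cancel)
qed

text \<open>Conjugation by the inverse root of \<open>c\<close> moves \<open>c\<close> to
  \<open>1\<close> and turns the reflection into inversion. Together with the companion bound below:
  \<open>x\<close> is at least twice as far from its reflection as from \<open>c\<close>.\<close>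

lemma cle_refl_at_sqrt:
  assumes "c \<in> ppos" "x \<in> ppos" "T > 0" "x \<preceq> T *\<^sub>R refl_at c x" shows "x \<preceq> sqrt T *\<^sub>R c"
proof -
  obtain r where r: "r \<in> ppos" "r * r = c" using ppos_root assms by blast
  let ?u = "cinv r * x * cinv r"
  have "?u \<preceq> cinv r * (T *\<^sub>R refl_at c x) * cinv r" using r assms by (intro cle_conj) auto
  also have "\<dots> = T *\<^sub>R cinv ?u" using conj_root_refl_at[OF r(1) assms(2)] r by simp
  finally have "?u \<preceq> sqrt T *\<^sub>R 1" using r assms by (intro cle_sqrt_of_cle_cinv) auto
  then have "r * ?u * r \<preceq> r * (sqrt T *\<^sub>R 1) * r" using r by (intro cle_conj) auto
  then show ?thesis using r by (simp add: mult.assoc cinv cinv_cancel)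
qed

lemma refl_at_cle_sqrt:
  assumes "c \<in> ppos" "x \<in> ppos" "T > 0" "refl_at c x \<preceq> T *\<^sub>R x" shows "c \<preceq> sqrt T *\<^sub>R x"
  using refl_at_antimono_iff[of c "refl_at c x" c "sqrt T"] cle_refl_at_sqrt[of c "refl_at c x" T] assms
  by simp

text \<open>The witness is the usual formula
  \<open>a^(1/2) (a^(-1/2) b a^(-1/2))^(1/2) a^(1/2)\<close>.\<close>

lemma geometric_mean_exists:
  assumes "a \<in> ppos" "b \<in> ppos" obtains c where "c \<in> ppos" "refl_at c a = b"
proof -
  obtain r where r: "r \<in> ppos" "r * r = a" using ppos_root assms by blast
  obtain w where w: "w \<in> ppos" "w * w = cinv r * b * cinv r"
    using ppos_root[of "cinv r * b * cinv r"] r assms by auto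
  have "cinv a = cinv r * cinv r" using cinv_conj[of r 1] r by simp
  then have "refl_at (r * w * r) a = r * (w * w) * r"
    using r by (simp add: refl_at_def mult.assoc cinv cinv_cancel)
  also have "\<dots> = b" unfolding w using r by (simp add: mult.assoc cinv cinv_cancel)
  finally show ?thesis using that[of "r * w * r"] r w by simp
qed

section \<open>Order isomorphisms preserve geometric means\<close>

lemma ppos_dominates:
  assumes "selfadjoint x" "a \<in> ppos" obtains t where "t > 0" "x \<preceq> t *\<^sub>R a"
proof -
  obtain \<delta> where d: "\<delta> > 0" "\<delta> *\<^sub>R 1 \<preceq> a" using assms(2) ppos_iff by blast
  define t where "t = (norm x + 1) / \<delta>"
  have t: "t > 0" using d by (simp add: t_def add_nonneg_pos)
  have "x \<preceq> (norm x + 1) *\<^sub>R 1" using assms by (intro cle_norm) auto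
  also have "(norm x + 1) *\<^sub>R 1 = t *\<^sub>R \<delta> *\<^sub>R (1::'a)" using d by (simp add: t_def)
  also have "t *\<^sub>R \<delta> *\<^sub>R 1 \<preceq> t *\<^sub>R a" using d t by (intro cle_scaleR) auto
  finally show ?thesis using that t by blast
qed

text \<open>Equivalently: a positively homogeneous order isomorphism between the cones of invertible
  positive elements, given together with its inverse.\<close>

definition gauge_iso ::
  "('a::unital_cstar_algebra \<Rightarrow> 'b::unital_cstar_algebra) \<Rightarrow> ('b \<Rightarrow> 'a) \<Rightarrow> bool"
  where "gauge_iso g g' \<longleftrightarrow>
    (\<forall>x\<in>ppos. g x \<in> ppos \<and> g' (g x) = x) \<and> (\<forall>y\<in>ppos. g' y \<in> ppos \<and> g (g' y) = y) \<and>
    (\<forall>x\<in>ppos. \<forall>y\<in>ppos. \<forall>t>0. x \<preceq> t *\<^sub>R y \<longleftrightarrow> g x \<preceq> t *\<^sub>R g y)"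

lemma gauge_isoD:
  assumes "gauge_iso g g'"
  shows "x \<in> ppos \<Longrightarrow> g x \<in> ppos" "x \<in> ppos \<Longrightarrow> g' (g x) = x"
    "y \<in> ppos \<Longrightarrow> g' y \<in> ppos" "y \<in> ppos \<Longrightarrow> g (g' y) = y"
    "x \<in> ppos \<Longrightarrow> z \<in> ppos \<Longrightarrow> t > 0 \<Longrightarrow> g x \<preceq> t *\<^sub>R g z \<longleftrightarrow> x \<preceq> t *\<^sub>R z"
  using assms unfolding gauge_iso_def by blast+

lemma gauge_iso_sym: "gauge_iso g g' \<Longrightarrow> gauge_iso g' g"
  unfolding gauge_iso_def by metis

text \<open>A reflection reverses the order, so one on each side of \<open>g\<close> restores
  it.\<close>

lemma gauge_iso_refl_at_conj:
  assumes "gauge_iso g g'" "c \<in> ppos" "d \<in> ppos"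
  shows "gauge_iso (\<lambda>x. refl_at d (g (refl_at c x))) (\<lambda>y. refl_at c (g' (refl_at d y)))"
  unfolding gauge_iso_def using assms
  by (simp add: gauge_isoD[OF assms(1)] refl_at_antimono_iff)

lemma gauge_iso_comp:
  assumes "gauge_iso g g'" "gauge_iso h h'"
  shows "gauge_iso (\<lambda>x. h (g x)) (\<lambda>y. g' (h' y))"
  unfolding gauge_iso_def by (simp add: gauge_isoD[OF assms(1)] gauge_isoD[OF assms(2)])

text \<open>Vaisala's proof of the Mazur--Ulam theorem, for the Thompson metric: replacing \<open>g\<close> by
  \<open>\<rho> g\<^sup>-\<^sup>1 \<rho> g\<close>, where \<open>\<rho>\<close> is the reflection in \<open>c\<close>, doubles the distance of \<open>g c\<close> to \<open>c\<close>,
  which is bounded a priori.\<close>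

lemma gauge_iso_fixes_midpoint:
  assumes c: "c \<in> ppos" and a: "a \<in> ppos" and g: "gauge_iso g g'" "g a = a" "g (refl_at c a) = refl_at c a"
  shows "g c = c"
proof -
  let ?\<rho> = "refl_at c"
  obtain t1 where t1: "t1 > 0" "c \<preceq> t1 *\<^sub>R a" using ppos_dominates c a by (metis ppos_sa)
  obtain t2 where t2: "t2 > 0" "a \<preceq> t2 *\<^sub>R c" using ppos_dominates c a by (metis ppos_sa)
  \<comment> \<open>A bound on the displacement of \<open>c\<close> common to all \<open>g\<close>
    that fix \<open>a\<close>. The induction varies \<open>g\<close>, so this uniformity is
    essential.\<close>
  define T where "T = t1 * t2"
  have T: "T > 0" using t1 t2 by (simp add: T_def)
  have key: "g c \<preceq> root (2^n) T *\<^sub>R c \<and> c \<preceq> root (2^n) T *\<^sub>R g c"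
    if "gauge_iso g g'" "g a = a" "g (?\<rho> a) = ?\<rho> a" for n g g'
    using that
  proof (induction n arbitrary: g g')
    case 0
    note gD = gauge_isoD[OF 0(1)]
    have "g c \<preceq> t1 *\<^sub>R a" using gD(5)[of c a t1] 0 a c t1 by simp
    also have "\<dots> \<preceq> t1 *\<^sub>R t2 *\<^sub>R c" using t1 t2 by (intro cle_scaleR) auto
    finally have 1: "g c \<preceq> T *\<^sub>R c" by (simp add: T_def)
    have "c \<preceq> t1 *\<^sub>R a" by fact
    also have "\<dots> \<preceq> t1 *\<^sub>R t2 *\<^sub>R g c" using gD(5)[of a c t2] 0 a c t1 t2 by (intro cle_scaleR) auto
    finally have "c \<preceq> T *\<^sub>R g c" by (simp add: T_def)
    with 1 show ?case by simp
  next
    case (Suc n)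
    note gD = gauge_isoD[OF Suc.prems(1)]
    let ?S = "root (2^n) T"
    have S: "?S > 0" "sqrt ?S = root (2^Suc n) T" using T by (simp_all add: sqrt_def real_root_mult_exp)
    \<comment> \<open>\<open>?h\<close> again fixes \<open>a\<close> and its reflection:
      \<open>g\<close> and \<open>g'\<close> fix both, and \<open>?\<rho>\<close> exchanges
      them.\<close>
    let ?h = "\<lambda>x. ?\<rho> (g' (?\<rho> (g x)))"
    have ga: "g' a = a" "g' (?\<rho> a) = ?\<rho> a" using gD(2)[OF a] gD(2)[of "?\<rho> a"] Suc.prems a c by simp_all
    have "?h c \<preceq> ?S *\<^sub>R c \<and> c \<preceq> ?S *\<^sub>R ?h c"
    proof (rule Suc.IH[of ?h "\<lambda>y. g' (?\<rho> (g (?\<rho> y)))"])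
      show "gauge_iso ?h (\<lambda>y. g' (?\<rho> (g (?\<rho> y))))"
        using gauge_iso_comp[OF Suc.prems(1) gauge_iso_refl_at_conj[OF gauge_iso_sym[OF Suc.prems(1)] c c]] .
    qed (use Suc.prems ga a c in simp_all)
    then have 1: "?\<rho> (g' (?\<rho> (g c))) \<preceq> ?S *\<^sub>R ?\<rho> c" "?\<rho> c \<preceq> ?S *\<^sub>R ?\<rho> (g' (?\<rho> (g c)))"
      using c by simp_all
    \<comment> \<open>Removing the outer reflection and applying \<open>g\<close> turns the bound
      for \<open>?h\<close> into one between \<open>g c\<close> and its own reflection; passing to
      \<open>sqrt ?S\<close> then halves the distance to \<open>c\<close>.\<close>
    have "c \<preceq> ?S *\<^sub>R g' (?\<rho> (g c))" "g' (?\<rho> (g c)) \<preceq> ?S *\<^sub>R c"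
      using 1 c S by (simp_all add: refl_at_antimono_iff gD del: refl_at_self)
    then have "g c \<preceq> ?S *\<^sub>R ?\<rho> (g c)" "?\<rho> (g c) \<preceq> ?S *\<^sub>R g c"
      using gD(5)[of c "g' (?\<rho> (g c))" ?S] gD(5)[of "g' (?\<rho> (g c))" c ?S] c S by (simp_all add: gD)
    then show ?case
      using cle_refl_at_sqrt[of c "g c" ?S] refl_at_cle_sqrt[of c "g c" ?S] c S by (simp add: gD)
  qed
  have lim: "(\<lambda>n. root (2^n) T) \<longlonglongrightarrow> 1"
    using LIMSEQ_subseq_LIMSEQ[OF LIMSEQ_root_const[OF T], of "\<lambda>n. 2^n"]
    by (simp add: strict_mono_def o_def)
  have "g c \<preceq> 1 *\<^sub>R c" "c \<preceq> 1 *\<^sub>R g c"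
    by (rule cle_limit[OF tendsto_const tendsto_scaleR[OF lim tendsto_const]], use key[OF g] in blast)+
  then show ?thesis using cle_antisym by simp
qed

lemma refl_at_fixed:
  assumes "c \<in> ppos" "x \<in> ppos" "refl_at c x = x" shows "x = c"
  using cle_refl_at_sqrt[of c x 1] refl_at_cle_sqrt[of c x 1] assms cle_antisym by simp

text \<open>Let \<open>d\<close> be the midpoint of the images of \<open>a\<close> and
  \<open>b\<close>. The map \<open>?g\<close> fixes \<open>a\<close> and \<open>b\<close>, hence
  their midpoint \<open>c\<close>; so \<open>\<phi> c\<close> is a fixed point of the reflection at
  \<open>d\<close>, and \<open>d\<close> is the only one.\<close>

lemma gauge_iso_refl_at:
  assumes \<phi>: "gauge_iso \<phi> \<phi>'" and c: "c \<in> ppos" and a: "a \<in> ppos"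
  shows "\<phi> (refl_at c a) = refl_at (\<phi> c) (\<phi> a)"
proof -
  note D = gauge_isoD[OF \<phi>]
  define b where "b = refl_at c a"
  have b: "b \<in> ppos" "refl_at c b = a" using a c by (simp_all add: b_def)
  obtain d where d: "d \<in> ppos" "refl_at d (\<phi> a) = \<phi> b" using geometric_mean_exists D a b by metis
  then have d': "refl_at d (\<phi> b) = \<phi> a" using D a by (metis refl_at_refl_at)
  let ?g = "\<lambda>x. refl_at c (\<phi>' (refl_at d (\<phi> x)))"
  have "?g c = c"
  proof (rule gauge_iso_fixes_midpoint[OF c a, of ?g "\<lambda>y. \<phi>' (refl_at d (\<phi> (refl_at c y)))"])
    show "gauge_iso ?g (\<lambda>y. \<phi>' (refl_at d (\<phi> (refl_at c y))))"
      using gauge_iso_comp[OF \<phi> gauge_iso_refl_at_conj[OF gauge_iso_sym[OF \<phi>] d(1) c]] .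
    show "?g a = a" using d b D by simp
    show "?g (refl_at c a) = refl_at c a" using d' a D by (simp add: b_def[symmetric])
  qed
  then have "\<phi>' (refl_at d (\<phi> c)) = c" using c d D by (metis refl_at_refl_at refl_at_ppos refl_at_self)
  then have "refl_at d (\<phi> c) = \<phi> c" using c d D by (metis refl_at_ppos)
  then have "\<phi> c = d" using refl_at_fixed c d D by blast
  then show ?thesis using d by (simp add: b_def)
qed

text \<open>The tail bound is exported because comparing \<open>\<phi>\<close> with its derivative
  takes a rate, not just convergence.\<close>

lemma converges_of_geometric_steps:
  fixes X :: "nat \<Rightarrow> 'a::banach"
  assumes "\<And>n. n \<ge> N \<Longrightarrow> norm (X (Suc n) - X n) \<le> c / 2^n"
  shows "convergent X" "n \<ge> N \<Longrightarrow> norm (X n - lim X) \<le> 2 * c / 2^n"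
proof -
  have dist: "norm (X (n + k) - X n) \<le> 2 * c / 2^n - 2 * c / 2^(n+k)" if "n \<ge> N" for n k
  proof (induction k)
    case (Suc k)
    have "norm (X (n + Suc k) - X n) \<le> norm (X (Suc (n + k)) - X (n + k)) + norm (X (n + k) - X n)"
      using norm_triangle_ineq[of "X (Suc (n + k)) - X (n + k)" "X (n + k) - X n"] by simp
    also have "\<dots> \<le> c / 2^(n+k) + (2 * c / 2^n - 2 * c / 2^(n+k))"
      using Suc assms[of "n + k"] that by (intro add_mono) auto
    also have "\<dots> = 2 * c / 2^n - 2 * c / 2^(n + Suc k)" by (simp add: field_simps)
    finally show ?case .
  qed simp
  have "0 \<le> c / 2^N" using assms[of N] norm_ge_zero order_trans by blast
  then have "0 \<le> c / 2^N * 2^N" by (intro mult_nonneg_nonneg) simp_all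
  then have c: "c \<ge> 0" by simp
  have dist': "norm (X (n + k) - X n) \<le> 2 * c / 2^n" if "n \<ge> N" for n k
    using dist[OF that, of k] c by (smt (verit) divide_nonneg_nonneg zero_le_power)
  have "Cauchy X"
  proof (rule CauchyI')
    fix e :: real assume e: "e > 0"
    have "(\<lambda>n. 2 * c * (1/2)^n) \<longlonglongrightarrow> 2 * c * 0" by (intro tendsto_intros LIMSEQ_power_zero) simp
    then have "eventually (\<lambda>n. 2 * c * (1/2)^n < e) sequentially" using e by (simp add: order_tendstoD)
    then obtain M where M: "\<And>n. n \<ge> M \<Longrightarrow> 2 * c * (1/2)^n < e" by (auto simp: eventually_sequentially)
    show "\<exists>M. \<forall>m\<ge>M. \<forall>n>m. dist (X m) (X n) < e"
    proof (intro exI allI impI)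
      fix m n assume mn: "max M N \<le> m" "m < n"
      have "dist (X m) (X n) \<le> 2 * c / 2^m" using dist'[of m "n - m"] mn by (simp add: dist_norm norm_minus_commute)
      also have "\<dots> < e" using M[of m] mn by (simp add: power_one_over)
      finally show "dist (X m) (X n) < e" .
    qed
  qed
  then show conv: "convergent X" by (rule Cauchy_convergent)
  show "norm (X n - lim X) \<le> 2 * c / 2^n" if "n \<ge> N"
  proof -
    have "(\<lambda>k. X (k + n)) \<longlonglongrightarrow> lim X" using conv LIMSEQ_ignore_initial_segment by (simp add: convergent_LIMSEQ_iff)
    then have "(\<lambda>k. norm (X (k + n) - X n)) \<longlonglongrightarrow> norm (lim X - X n)" by (intro tendsto_intros)
    then have "norm (lim X - X n) \<le> 2 * c / 2^n"
      using dist'[OF that] by (intro LIMSEQ_le_const2) (auto simp: add.commute)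
    then show ?thesis by (simp add: norm_minus_commute)
  qed
qed

text \<open>With the inverse as a parameter the hypotheses are symmetric, so every result is
  available for \<open>\<phi>'\<close> through \<open>inverse_iso\<close>.\<close>

locale unital_gauge_iso =
  fixes \<phi> :: "'a::unital_cstar_algebra \<Rightarrow> 'b::unital_cstar_algebra" and \<phi>' :: "'b \<Rightarrow> 'a"
  assumes iso: "gauge_iso \<phi> \<phi>'" and unit: "\<phi> 1 = 1"
begin

lemmas isoD = gauge_isoD[OF iso]

lemma inverse_iso: "unital_gauge_iso \<phi>' \<phi>"
  using gauge_iso_sym[OF iso] isoD(2)[of 1] unit by (simp add: unital_gauge_iso_def)

lemma mono: "x \<in> ppos \<Longrightarrow> y \<in> ppos \<Longrightarrow> x \<preceq> y \<Longrightarrow> \<phi> x \<preceq> \<phi> y"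
  using isoD(5)[of x y 1] by simp

lemma homogeneous:
  assumes "x \<in> ppos" "t > 0" shows "\<phi> (t *\<^sub>R x) = t *\<^sub>R \<phi> x"
proof (rule cle_antisym)
  show "\<phi> (t *\<^sub>R x) \<preceq> t *\<^sub>R \<phi> x" using isoD(5)[of "t *\<^sub>R x" x t] assms by simp
  have "\<phi> x \<preceq> (1/t) *\<^sub>R \<phi> (t *\<^sub>R x)" using isoD(5)[of x "t *\<^sub>R x" "1/t"] assms by simp
  then show "t *\<^sub>R \<phi> x \<preceq> \<phi> (t *\<^sub>R x)" using cle_scaleR[of _ _ t] assms by fastforce
qed

lemma map_cinv: "x \<in> ppos \<Longrightarrow> \<phi> (cinv x) = cinv (\<phi> x)"
  using gauge_iso_refl_at[OF iso ppos_1] by (simp add: refl_at_def unit)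

text \<open>\<open>c * x * c\<close> arises from \<open>x\<close> by two reflections, at
  \<open>1\<close> and then at \<open>c\<close>.\<close>

lemma map_conj: "c \<in> ppos \<Longrightarrow> x \<in> ppos \<Longrightarrow> \<phi> (c * x * c) = \<phi> c * \<phi> x * \<phi> c"
  using gauge_iso_refl_at[OF iso, of c "cinv x"] by (simp add: refl_at_def map_cinv isoD)

lemma map_sq: "c \<in> ppos \<Longrightarrow> \<phi> (c * c) = \<phi> c * \<phi> c"
  using map_conj[of c 1] by (simp add: unit)

end

section \<open>The derivative at the unit\<close>

lemma one_plus_bounds:
  assumes "selfadjoint a" "0 \<le> s" "norm a \<le> R"
  shows "1 + s *\<^sub>R a \<preceq> (1 + s * R) *\<^sub>R 1" "(1 - s * R) *\<^sub>R 1 \<preceq> 1 + s *\<^sub>R a"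
proof -
  have n: "norm (s *\<^sub>R a) \<le> s * R" using assms by (simp add: mult_left_mono)
  have "1 + s *\<^sub>R a \<preceq> 1 + (s * R) *\<^sub>R 1" using assms n by (intro cle_add_left cle_norm) auto
  then show "1 + s *\<^sub>R a \<preceq> (1 + s * R) *\<^sub>R 1" by (simp add: scaleR_add_left)
  have "1 + (- (s * R)) *\<^sub>R 1 \<preceq> 1 + s *\<^sub>R a" using assms n by (intro cle_add_left cle_minus_norm) auto
  then show "(1 - s * R) *\<^sub>R 1 \<preceq> 1 + s *\<^sub>R a" by (simp add: scaleR_diff_left)
qed

lemma ppos_one_plus:
  assumes "selfadjoint a" "0 \<le> s" "s * norm a < 1" shows "1 + s *\<^sub>R a \<in> ppos"
  unfolding ppos_iff using one_plus_bounds(2)[OF assms(1,2) order_refl] assms(3)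
  by (intro exI[of _ "1 - s * norm a"]) simp

lemma ppos_one_plus_pos: "p \<in> pos_cone \<Longrightarrow> 0 \<le> s \<Longrightarrow> 1 \<preceq> 1 + s *\<^sub>R p"
  using cle_add_left[of 0 "s *\<^sub>R p" 1] by (simp add: pos_cone_scaleR)

lemma eventually_small:
  assumes "c > 0" shows "\<forall>\<^sub>F n in sequentially. 1/2^n * (R::real) < c"
proof -
  have "(\<lambda>n. (1/2)^n * R) \<longlonglongrightarrow> 0 * R" by (intro tendsto_intros LIMSEQ_power_zero) simp
  then show ?thesis using assms by (simp add: order_tendstoD power_one_over)
qed

context unital_gauge_iso
begin

definition quot :: "real \<Rightarrow> 'a \<Rightarrow> 'b"
  where "quot s a = (1/s) *\<^sub>R (\<phi> (1 + s *\<^sub>R a) - 1)"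

lemma map_one_plus: "s > 0 \<Longrightarrow> \<phi> (1 + s *\<^sub>R a) = 1 + s *\<^sub>R quot s a"
  by (simp add: quot_def)

lemma map_scalar: "t > 0 \<Longrightarrow> \<phi> (t *\<^sub>R 1) = t *\<^sub>R 1"
  using homogeneous[of 1 t] unit by simp

lemma map_one_plus_bounds:
  assumes "selfadjoint a" "0 < s" "s * norm a < 1"
  shows "\<phi> (1 + s *\<^sub>R a) \<preceq> (1 + s * norm a) *\<^sub>R 1" "(1 - s * norm a) *\<^sub>R 1 \<preceq> \<phi> (1 + s *\<^sub>R a)"
proof -
  have "0 \<le> s * norm a" using assms by simp
  then have p: "1 + s * norm a > 0" "1 - s * norm a > 0" using assms by linarith+
  have P: "1 + s *\<^sub>R a \<in> ppos" using assms by (intro ppos_one_plus) auto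
  show "\<phi> (1 + s *\<^sub>R a) \<preceq> (1 + s * norm a) *\<^sub>R 1"
    using mono[OF P ppos_scaleR[OF ppos_1 p(1)] one_plus_bounds(1)[OF assms(1) _ order_refl]] assms p
    by (simp add: map_scalar)
  show "(1 - s * norm a) *\<^sub>R 1 \<preceq> \<phi> (1 + s *\<^sub>R a)"
    using mono[OF ppos_scaleR[OF ppos_1 p(2)] P one_plus_bounds(2)[OF assms(1) _ order_refl]] assms p
    by (simp add: map_scalar)
qed

lemma quot_sa:
  assumes "selfadjoint a" "0 < s" "s * norm a < 1" shows "selfadjoint (quot s a)"
  using isoD(1)[OF ppos_one_plus[of a s]] assms by (simp add: quot_def)

lemma quot_norm:
  assumes "selfadjoint a" "0 < s" "s * norm a < 1" shows "norm (quot s a) \<le> norm a"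
proof -
  let ?d = "\<phi> (1 + s *\<^sub>R a) - 1"
  have "?d \<preceq> (s * norm a) *\<^sub>R 1" "(- (s * norm a)) *\<^sub>R 1 \<preceq> ?d"
    using cle_add_right[OF map_one_plus_bounds(1)[OF assms], of "-1"]
      cle_add_right[OF map_one_plus_bounds(2)[OF assms], of "-1"] by (simp_all add: algebra_simps)
  then have "norm ?d \<le> s * norm a" using assms by (intro norm_le_of_cle) auto
  moreover have "norm (quot s a) = norm ?d / s" using assms by (simp add: quot_def)
  ultimately show ?thesis using assms by (simp add: divide_le_eq mult.commute)
qed

text \<open>Order and homogeneity suffice. As \<open>1 + s b\<close> is at least \<open>1/2\<close>,
  \<open>1 + s a \<preceq> (1 + 2 s \<delta>) (1 + s b)\<close>; \<open>\<phi>\<close> respects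
  this, and \<open>\<phi> (1 + s b) \<preceq> 3/2\<close> yields the constant
  \<open>3 = 2 * 3/2\<close>.\<close>

lemma quot_lipschitz:
  assumes "selfadjoint a" "selfadjoint b" "0 < s" "s * norm a \<le> 1/2" "s * norm b \<le> 1/2"
  shows "norm (quot s a - quot s b) \<le> 3 * norm (a - b)"
proof -
  define \<delta> where "\<delta> = norm (a - b)"
  have upper: "\<phi> (1 + s *\<^sub>R a) - \<phi> (1 + s *\<^sub>R b) \<preceq> (3 * s * \<delta>) *\<^sub>R 1"
    if "selfadjoint a" "selfadjoint b" "s * norm a \<le> 1/2" "s * norm b \<le> 1/2" "\<delta> = norm (a - b)" for a b :: 'a
  proof -
    let ?y = "1 + s *\<^sub>R b"
    have \<delta>0: "\<delta> \<ge> 0" using that by simp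
    have P: "1 + s *\<^sub>R a \<in> ppos" "?y \<in> ppos" using that assms(3) by (auto intro: ppos_one_plus)
    have fac: "1 + 2 * s * \<delta> > 0" using \<delta>0 assms(3) by (simp add: add_pos_nonneg)
    have "(1 - s * norm b) *\<^sub>R 1 \<preceq> ?y" using that assms(3) by (intro one_plus_bounds) auto
    moreover have "(1/2) *\<^sub>R 1 \<preceq> (1 - s * norm b) *\<^sub>R (1::'a)" using that by (intro cle_scaleR_left) auto
    ultimately have "(1/2) *\<^sub>R 1 \<preceq> ?y" using cle_trans by blast
    then have "(2 * s * \<delta>) *\<^sub>R (1/2) *\<^sub>R 1 \<preceq> (2 * s * \<delta>) *\<^sub>R ?y"
      by (rule cle_scaleR) (use \<delta>0 assms(3) in simp)
    moreover have "s *\<^sub>R (a - b) \<preceq> (s * \<delta>) *\<^sub>R 1" using that assms(3) by (intro cle_norm) auto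
    ultimately have "s *\<^sub>R (a - b) \<preceq> (2 * s * \<delta>) *\<^sub>R ?y" using cle_trans by fastforce
    then have "?y + s *\<^sub>R (a - b) \<preceq> ?y + (2 * s * \<delta>) *\<^sub>R ?y" by (rule cle_add_left) (use that in auto)
    moreover have "?y + s *\<^sub>R (a - b) = 1 + s *\<^sub>R a" by (simp add: scaleR_diff_right)
    moreover have "?y + (2 * s * \<delta>) *\<^sub>R ?y = (1 + 2 * s * \<delta>) *\<^sub>R ?y" by (simp only: scaleR_add_left scaleR_one)
    ultimately have "1 + s *\<^sub>R a \<preceq> (1 + 2 * s * \<delta>) *\<^sub>R ?y" by simp
    then have 1: "\<phi> (1 + s *\<^sub>R a) \<preceq> (1 + 2 * s * \<delta>) *\<^sub>R \<phi> ?y" using isoD(5)[OF P fac] by blast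
    have "\<phi> ?y \<preceq> (1 + s * norm b) *\<^sub>R 1" using that assms(3) by (intro map_one_plus_bounds) auto
    moreover have "(1 + s * norm b) *\<^sub>R (1::'b) \<preceq> (3/2) *\<^sub>R 1" using that by (intro cle_scaleR_left) auto
    ultimately have "\<phi> ?y \<preceq> (3/2) *\<^sub>R 1" using cle_trans by blast
    then have 2: "(2 * s * \<delta>) *\<^sub>R \<phi> ?y \<preceq> (2 * s * \<delta>) *\<^sub>R (3/2) *\<^sub>R 1"
      by (rule cle_scaleR) (use \<delta>0 assms(3) in simp)
    have sy: "selfadjoint (\<phi> ?y)" using P isoD by simp
    have "\<phi> (1 + s *\<^sub>R a) - \<phi> ?y \<preceq> (2 * s * \<delta>) *\<^sub>R \<phi> ?y"
      using cle_add_right[OF 1, of "- \<phi> ?y"] sy by (simp add: scaleR_add_left)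
    then have "\<phi> (1 + s *\<^sub>R a) - \<phi> ?y \<preceq> (2 * s * \<delta>) *\<^sub>R (3/2) *\<^sub>R 1" using 2 cle_trans by blast
    moreover have "(2 * s * \<delta>) *\<^sub>R (3/2) *\<^sub>R (1::'b) = (3 * s * \<delta>) *\<^sub>R 1" by simp
    ultimately show ?thesis by (simp only:)
  qed
  let ?d = "\<phi> (1 + s *\<^sub>R a) - \<phi> (1 + s *\<^sub>R b)"
  have "?d \<preceq> (3 * s * \<delta>) *\<^sub>R 1" using assms by (intro upper) (auto simp: \<delta>_def)
  moreover have "- ?d \<preceq> (3 * s * \<delta>) *\<^sub>R 1"
    using upper[of b a] assms by (simp add: \<delta>_def norm_minus_commute)
  then have "(- (3 * s * \<delta>)) *\<^sub>R 1 \<preceq> ?d" using cle_minus[of "- ?d"] by simp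
  ultimately have "norm ?d \<le> 3 * s * \<delta>" using assms by (intro norm_le_of_cle) (auto simp: \<delta>_def)
  moreover have "quot s a - quot s b = (1/s) *\<^sub>R ?d" by (simp add: quot_def scaleR_diff_right)
  then have "norm (quot s a - quot s b) = norm ?d / s" using assms by simp
  ultimately show ?thesis using assms by (simp add: \<delta>_def divide_le_eq mult.commute mult.left_commute)
qed

text \<open>Comparing \<open>\<phi> ((1 + s a)\<^sup>2)\<close> with \<open>\<phi> (1 + s a)\<^sup>2\<close> relates the difference quotients at \<open>s\<close> and \<open>2 s\<close>.\<close>

lemma quot_step:
  assumes "selfadjoint a" "0 < s" "s * norm a \<le> 1/8"
  shows "norm (quot (2 * s) a - quot s a) \<le> 2 * s * (norm a)\<^sup>2"
proof -
  \<comment> \<open>Chosen so that \<open>(1 + s a)^2 = 1 + 2 s b\<close>.\<close>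
  define b where "b = a + (s/2) *\<^sub>R (a * a)"
  define A where "A = quot s a"
  have A: "norm A \<le> norm a" using assms by (auto simp: A_def intro: quot_norm)
  have sb: "selfadjoint b" using assms by (simp add: b_def)
  have na: "norm (a * a) \<le> (norm a)\<^sup>2" "norm (A * A) \<le> (norm a)\<^sup>2"
    using norm_mult_ineq[of a a] norm_mult_ineq[of A A] mult_mono[OF A A]
    by (simp_all add: power2_eq_square)
  \<comment> \<open>The hypothesis with \<open>1/8\<close> gives
    \<open>2 s (norm b) \<le> 1/4 + 1/64\<close>, within the \<open>1/2\<close> that the Lipschitz
    bound requires.\<close>
  have "norm b \<le> norm a + (s/2) * norm (a * a)"
    using norm_triangle_ineq[of a "(s/2) *\<^sub>R (a * a)"] assms by (simp add: b_def)
  also have "\<dots> \<le> norm a + (s/2) * (norm a)\<^sup>2" using na assms by (intro add_left_mono mult_left_mono) auto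
  finally have "2 * s * norm b \<le> 2 * s * (norm a + (s/2) * (norm a)\<^sup>2)" using assms by (intro mult_left_mono) auto
  also have "\<dots> = 2 * (s * norm a) + (s * norm a)\<^sup>2" using assms by (simp add: field_simps power2_eq_square)
  also have "\<dots> \<le> 2 * (1/8) + (1/8)\<^sup>2" using assms by (intro add_mono mult_left_mono power_mono) auto
  finally have nb: "2 * s * norm b \<le> 1/2" by (simp add: power2_eq_square)
  have "1 + (2 * s) *\<^sub>R b = (1 + s *\<^sub>R a) * (1 + s *\<^sub>R a)"
    by (simp add: b_def algebra_simps scaleR_2[symmetric] power2_eq_square)
  then have "\<phi> (1 + (2 * s) *\<^sub>R b) = (1 + s *\<^sub>R A) * (1 + s *\<^sub>R A)"
    using map_sq[OF ppos_one_plus[of a s]] assms by (simp add: map_one_plus A_def)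
  also have "\<dots> = 1 + (2 * s) *\<^sub>R (A + (s/2) *\<^sub>R (A * A))"
    by (simp add: algebra_simps scaleR_2[symmetric] power2_eq_square)
  finally have "(2 * s) *\<^sub>R quot (2 * s) b = (2 * s) *\<^sub>R (A + (s/2) *\<^sub>R (A * A))"
    using map_one_plus[of "2 * s" b] assms by simp
  then have qb: "quot (2 * s) b = A + (s/2) *\<^sub>R (A * A)" using assms by (simp only: scaleR_cancel_left) auto
  have "norm (quot (2 * s) a - quot (2 * s) b) \<le> 3 * norm (a - b)"
    using assms sb nb by (intro quot_lipschitz) auto
  also have "\<dots> = 3 * ((s/2) * norm (a * a))" using assms by (simp add: b_def)
  also have "\<dots> \<le> 3 * ((s/2) * (norm a)\<^sup>2)" using na assms by (intro mult_left_mono) auto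
  finally have 1: "norm (quot (2 * s) a - quot (2 * s) b) \<le> 3 * ((s/2) * (norm a)\<^sup>2)" .
  have "norm (quot (2 * s) b - A) = (s/2) * norm (A * A)" using assms by (simp add: qb)
  also have "\<dots> \<le> (s/2) * (norm a)\<^sup>2" using na assms by (intro mult_left_mono) auto
  finally have 2: "norm (quot (2 * s) b - A) \<le> (s/2) * (norm a)\<^sup>2" .
  \<comment> \<open>A share \<open>3/2\<close> from replacing \<open>b\<close> by \<open>a\<close>
    and \<open>1/2\<close> from the term with \<open>A * A\<close> make up the factor
    \<open>2\<close>.\<close>
  have "norm (quot (2 * s) a - A) \<le> norm (quot (2 * s) a - quot (2 * s) b) + norm (quot (2 * s) b - A)"
    using norm_triangle_ineq[of "quot (2 * s) a - quot (2 * s) b" "quot (2 * s) b - A"] by simp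
  then show ?thesis using 1 2 by (simp add: A_def)
qed

definition deriv_one :: "'a \<Rightarrow> 'b"
  where "deriv_one a = lim (\<lambda>n. quot (1/2^n) a)"

text \<open>At \<open>s = 1/2^(m+1)\<close> the preceding estimate bounds increments by
  \<open>R^2/2^m\<close>, and \<open>1/4\<close> keeps \<open>s (norm a)\<close> within
  \<open>1/8\<close>. \<open>R\<close> is separate from \<open>norm a\<close> to make the rate
  uniform over bounded families.\<close>

lemma quot_deriv_one_bound:
  assumes "selfadjoint a" "norm a \<le> R" "1/2^n * R \<le> 1/4"
  shows "convergent (\<lambda>n. quot (1/2^n) a)" "norm (quot (1/2^n) a - deriv_one a) \<le> 2 * R\<^sup>2 / 2^n"
proof -
  have "norm (quot (1/2^Suc m) a - quot (1/2^m) a) \<le> R\<^sup>2 / 2^m" if "m \<ge> n" for m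
  proof -
    let ?s = "1 / 2^Suc m :: real"
    have s: "2 * ?s = 1 / 2^m" by simp
    have "1/2^m * norm a \<le> 1/2^n * R"
      using assms that norm_ge_zero[of a] by (intro mult_mono) (auto simp: field_simps power_increasing)
    then have "1/2^m * norm a \<le> 1/4" using assms(3) by linarith
    then have "?s * norm a \<le> 1/8" by simp
    then have "norm (quot (2 * ?s) a - quot ?s a) \<le> 2 * ?s * (norm a)\<^sup>2"
      using assms by (intro quot_step) auto
    also have "\<dots> \<le> 2 * ?s * R\<^sup>2" using assms by (intro mult_left_mono power_mono) auto
    finally show ?thesis unfolding s by (simp add: norm_minus_commute)
  qed
  note step = this
  show "convergent (\<lambda>n. quot (1/2^n) a)"
    by (rule converges_of_geometric_steps(1)[where N = n and c = "R\<^sup>2"]) (rule step)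
  show "norm (quot (1/2^n) a - deriv_one a) \<le> 2 * R\<^sup>2 / 2^n"
    unfolding deriv_one_def
    by (rule converges_of_geometric_steps(2)[where N = n and c = "R\<^sup>2"]) (rule step, auto)
qed

lemma deriv_one_LIMSEQ:
  assumes "selfadjoint a" shows "(\<lambda>n. quot (1/2^n) a) \<longlonglongrightarrow> deriv_one a"
proof -
  obtain n where "1/2^n * norm a < 1/4"
    using eventually_happens[OF eventually_small[of "1/4" "norm a"]] by auto
  then show ?thesis using quot_deriv_one_bound(1)[of a "norm a" n] assms
    by (simp add: deriv_one_def convergent_LIMSEQ_iff)
qed

text \<open>The argument may move with the step size, since products such as
  \<open>(1 + s a) (1 + s b) (1 + s a)\<close> have the form \<open>1 + s x\<close> with
  \<open>x\<close> depending on \<open>s\<close>. The uniform Lipschitz bound absorbs the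
  motion.\<close>

lemma quot_LIMSEQ:
  assumes "X \<longlonglongrightarrow> a" "\<forall>\<^sub>F n in sequentially. selfadjoint (X n)" "selfadjoint a"
  shows "(\<lambda>n. quot (1/2^n) (X n)) \<longlonglongrightarrow> deriv_one a"
proof -
  have "\<forall>\<^sub>F n in sequentially. norm (X n) < norm a + 1"
    using tendsto_norm[OF assms(1)] by (rule order_tendstoD) simp
  then have "\<forall>\<^sub>F n in sequentially. norm (quot (1/2^n) (X n) - quot (1/2^n) a) \<le> 3 * norm (X n - a)"
    using assms(2) eventually_small[OF half_gt_zero[OF zero_less_one], of "norm a + 1"]
  proof eventually_elim
    case (elim n)
    have "1/2^n * norm (X n) \<le> 1/2^n * (norm a + 1)" "1/2^n * norm a \<le> 1/2^n * (norm a + 1)"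
      using elim(1) by (intro mult_left_mono; simp)+
    then show ?case using elim assms by (intro quot_lipschitz) auto
  qed
  moreover have "(\<lambda>n. 3 * norm (X n - a)) \<longlonglongrightarrow> 3 * norm (a - a)" by (intro tendsto_intros assms)
  then have "(\<lambda>n. 3 * norm (X n - a)) \<longlonglongrightarrow> 0" by simp
  ultimately have "(\<lambda>n. quot (1/2^n) (X n) - quot (1/2^n) a) \<longlonglongrightarrow> 0"
    by (rule Lim_null_comparison)
  from tendsto_add[OF this deriv_one_LIMSEQ[OF assms(3)]] show ?thesis by simp
qed

lemma eventually_quot_sa:
  assumes "selfadjoint a" shows "\<forall>\<^sub>F n in sequentially. selfadjoint (quot (1/2^n) a)"
  using eventually_small[OF zero_less_one, of "norm a"] by eventually_elim (use assms in \<open>auto intro: quot_sa\<close>)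

lemma deriv_one_sa:
  assumes "selfadjoint a" shows "selfadjoint (deriv_one a)"
proof -
  obtain N where "\<And>n. n \<ge> N \<Longrightarrow> selfadjoint (quot (1/2^n) a)"
    using eventually_quot_sa[OF assms] by (auto simp: eventually_sequentially)
  then show ?thesis
    using sa_limit[OF LIMSEQ_ignore_initial_segment[OF deriv_one_LIMSEQ[OF assms], of N]] by simp
qed

lemma deriv_one_norm:
  assumes "selfadjoint a" shows "norm (deriv_one a) \<le> norm a"
proof -
  have "\<forall>\<^sub>F n in sequentially. norm (quot (1/2^n) a) \<le> norm a"
    using eventually_small[OF zero_less_one, of "norm a"] by eventually_elim (use assms in \<open>auto intro: quot_norm\<close>)
  then show ?thesis
    using tendsto_upperbound[OF tendsto_norm[OF deriv_one_LIMSEQ[OF assms]]] by simp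
qed

lemma deriv_one_pos:
  assumes "p \<in> pos_cone" shows "deriv_one p \<in> pos_cone"
proof (rule pos_cone_limit[OF deriv_one_LIMSEQ])
  fix n :: nat
  let ?s = "1/2^n :: real"
  have le: "1 \<preceq> 1 + ?s *\<^sub>R p" by (rule ppos_one_plus_pos[OF assms]) simp
  then have "1 + ?s *\<^sub>R p \<in> ppos" using ppos_cle ppos_1 by blast
  then have "1 \<preceq> \<phi> (1 + ?s *\<^sub>R p)" using mono[OF ppos_1] le unit by simp
  then have "\<phi> (1 + ?s *\<^sub>R p) - 1 \<in> pos_cone" by (rule cle_sa)
  then show "quot ?s p \<in> pos_cone" unfolding quot_def by (intro pos_cone_scaleR) auto
qed (use assms sa_pos_cone in blast)

lemma deriv_one_one: "deriv_one 1 = 1"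
proof -
  have "quot (1/2^n) 1 = 1" for n :: nat
    using map_scalar[of "1 + 1/2^n"] by (simp add: quot_def scaleR_add_left add_pos_pos)
  then show ?thesis using deriv_one_LIMSEQ[of 1] by (simp add: LIMSEQ_const_iff)
qed

text \<open>First order part of \<open>\<phi> (c x c) = \<phi> c \<phi> x \<phi> c\<close> at
  \<open>c = 1 + s a\<close> and \<open>x = 1 + s b\<close>; the factor \<open>2\<close> is due to
  \<open>c\<close> occurring twice.\<close>

lemma deriv_one_double_add:
  assumes a: "selfadjoint a" and b: "selfadjoint b"
  shows "deriv_one (2 *\<^sub>R a + b) = 2 *\<^sub>R deriv_one a + deriv_one b"
proof -
  let ?s = "\<lambda>n. 1/2^n :: real"
  have expand: "(1 + s *\<^sub>R x) * (1 + s *\<^sub>R y) * (1 + s *\<^sub>R x) = 1 + s *\<^sub>R (2 *\<^sub>R x + y + s *\<^sub>R (x * x + x * y + y * x + s *\<^sub>R (x * y * x)))"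
    for s :: real and x y :: "'c::unital_cstar_algebra"
    by (simp add: algebra_simps scaleR_2)
  have s0: "?s \<longlonglongrightarrow> 0" using LIMSEQ_power_zero[of "1/2::real"] by (simp add: power_one_over)
  define X where "X n = 2 *\<^sub>R a + b + ?s n *\<^sub>R (a * a + a * b + b * a + ?s n *\<^sub>R (a * b * a))" for n
  have sab: "selfadjoint (a * b + b * a)" using a b by (simp add: selfadjoint_def star_add star_mult add.commute)
  have "selfadjoint (a * a + a * b + b * a)"
    using sa_add[OF sa_sq[OF a] sab] by (simp add: add.assoc)
  then have "selfadjoint (X n)" for n using a b by (simp add: X_def)
  moreover have "X \<longlonglongrightarrow> 2 *\<^sub>R a + b + 0 *\<^sub>R (a * a + a * b + b * a + 0 *\<^sub>R (a * b * a))"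
    unfolding X_def by (intro tendsto_intros s0)
  ultimately have 1: "(\<lambda>n. quot (?s n) (X n)) \<longlonglongrightarrow> deriv_one (2 *\<^sub>R a + b)"
    using a b by (intro quot_LIMSEQ) auto
  define A where "A n = quot (?s n) a" for n
  define B where "B n = quot (?s n) b" for n
  have AB: "A \<longlonglongrightarrow> deriv_one a" "B \<longlonglongrightarrow> deriv_one b"
    unfolding A_def B_def using a b by (intro deriv_one_LIMSEQ; simp)+
  have eq: "\<forall>\<^sub>F n in sequentially. quot (?s n) (X n) =
      2 *\<^sub>R A n + B n + ?s n *\<^sub>R (A n * A n + A n * B n + B n * A n + ?s n *\<^sub>R (A n * B n * A n))"
    using eventually_small[OF zero_less_one, of "norm a"] eventually_small[OF zero_less_one, of "norm b"]
  proof eventually_elim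
    case (elim n)
    have s: "?s n > 0" by simp
    have P: "1 + ?s n *\<^sub>R a \<in> ppos" "1 + ?s n *\<^sub>R b \<in> ppos"
      using elim a b by (auto intro!: ppos_one_plus)
    have "1 + ?s n *\<^sub>R quot (?s n) (X n) = \<phi> ((1 + ?s n *\<^sub>R a) * (1 + ?s n *\<^sub>R b) * (1 + ?s n *\<^sub>R a))"
      unfolding expand map_one_plus[OF s, symmetric] X_def ..
    also have "\<dots> = (1 + ?s n *\<^sub>R A n) * (1 + ?s n *\<^sub>R B n) * (1 + ?s n *\<^sub>R A n)"
      unfolding map_conj[OF P] map_one_plus[OF s] A_def B_def ..
    finally have "?s n *\<^sub>R quot (?s n) (X n) =
      ?s n *\<^sub>R (2 *\<^sub>R A n + B n + ?s n *\<^sub>R (A n * A n + A n * B n + B n * A n + ?s n *\<^sub>R (A n * B n * A n)))"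
      unfolding expand add_left_cancel .
    then show ?case using s by (simp only: scaleR_cancel_left) auto
  qed
  have "(\<lambda>n. 2 *\<^sub>R A n + B n + ?s n *\<^sub>R (A n * A n + A n * B n + B n * A n + ?s n *\<^sub>R (A n * B n * A n)))
    \<longlonglongrightarrow> 2 *\<^sub>R deriv_one a + deriv_one b + 0 *\<^sub>R (deriv_one a * deriv_one a + deriv_one a * deriv_one b
      + deriv_one b * deriv_one a + 0 *\<^sub>R (deriv_one a * deriv_one b * deriv_one a))"
    by (intro tendsto_intros s0 AB)
  from Lim_transform_eventually[OF this, of "\<lambda>n. quot (?s n) (X n)"] eq
  have "(\<lambda>n. quot (?s n) (X n)) \<longlonglongrightarrow> 2 *\<^sub>R deriv_one a + deriv_one b" by (simp add: eq_commute)
  then show ?thesis using 1 LIMSEQ_unique by blast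
qed

lemma deriv_one_zero [simp]: "deriv_one 0 = 0"
  using deriv_one_norm[of 0] by simp

lemma deriv_one_add:
  assumes "selfadjoint a" "selfadjoint b" shows "deriv_one (a + b) = deriv_one a + deriv_one b"
  using deriv_one_double_add[of "(1/2) *\<^sub>R a" b] deriv_one_double_add[of "(1/2) *\<^sub>R a" 0] assms by simp

lemma deriv_one_minus:
  assumes "selfadjoint a" shows "deriv_one (- a) = - deriv_one a"
  using deriv_one_add[of a "- a"] assms by (simp add: eq_neg_iff_add_eq_0 add.commute)

lemma deriv_one_diff:
  assumes "selfadjoint a" "selfadjoint b" shows "deriv_one (a - b) = deriv_one a - deriv_one b"
  using deriv_one_add[of a "- b"] deriv_one_minus assms by simp

lemma deriv_one_of_nat:
  assumes "selfadjoint a" shows "deriv_one (of_nat n *\<^sub>R a) = of_nat n *\<^sub>R deriv_one a"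
  using assms by (induction n) (simp_all add: scaleR_add_left deriv_one_add)

lemma deriv_one_of_int:
  assumes "selfadjoint a" shows "deriv_one (of_int k *\<^sub>R a) = of_int k *\<^sub>R deriv_one a"
  using assms by (cases k) (simp_all add: deriv_one_of_nat deriv_one_minus del: of_nat_Suc)

text \<open>Additivity handles the integer part of \<open>n t\<close> and the norm bound its
  fractional part \<open>r\<close>. So the defect \<open>e\<close> satisfies
  \<open>n (norm e) \<le> 2 (norm a)\<close> for all \<open>n\<close>.\<close>

lemma deriv_one_scaleR:
  assumes a: "selfadjoint a" shows "deriv_one (t *\<^sub>R a) = t *\<^sub>R deriv_one a"
proof -
  define e where "e = deriv_one (t *\<^sub>R a) - t *\<^sub>R deriv_one a"
  have bound: "of_nat n * norm e \<le> 2 * norm a" for n :: nat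
  proof -
    define k where "k = \<lfloor>of_nat n * t\<rfloor>"
    define r where "r = of_nat n * t - of_int k"
    have r: "\<bar>r\<bar> \<le> 1" unfolding r_def k_def by linarith
    have "of_nat n *\<^sub>R deriv_one (t *\<^sub>R a) = deriv_one (of_int k *\<^sub>R a + r *\<^sub>R a)"
      using deriv_one_of_nat[of "t *\<^sub>R a" n] a by (simp add: r_def scaleR_add_left[symmetric])
    also have "\<dots> = of_int k *\<^sub>R deriv_one a + deriv_one (r *\<^sub>R a)"
      using a by (simp add: deriv_one_add deriv_one_of_int)
    finally have "of_nat n *\<^sub>R e = deriv_one (r *\<^sub>R a) - r *\<^sub>R deriv_one a"
      by (simp add: e_def r_def scaleR_diff_right scaleR_diff_left)
    then have "of_nat n * norm e \<le> norm (deriv_one (r *\<^sub>R a)) + norm (r *\<^sub>R deriv_one a)"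
      by (metis norm_scaleR norm_triangle_ineq4 abs_of_nat)
    also have "norm (deriv_one (r *\<^sub>R a)) \<le> norm a"
      using deriv_one_norm[of "r *\<^sub>R a"] a r mult_right_mono[OF r norm_ge_zero[of a]] by simp
    also have "norm (r *\<^sub>R deriv_one a) \<le> norm a"
      using deriv_one_norm[OF a] r mult_mono[OF r deriv_one_norm[OF a]] by simp
    finally show ?thesis by simp
  qed
  have "norm e = 0"
  proof (rule ccontr)
    assume "norm e \<noteq> 0"
    then have "norm e > 0" by simp
    then obtain n :: nat where "2 * norm a < of_nat n * norm e" using reals_Archimedean3 by blast
    then show False using bound[of n] by simp
  qed
  then show ?thesis by (simp add: e_def)
qed

text \<open>At each small step the quotients of \<open>\<phi>\<close> and \<open>\<phi>'\<close> are
  exactly inverse, and the limit with moving argument passes this on to the derivatives.\<close>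

lemma deriv_one_inverse:
  assumes "selfadjoint a"
  shows "unital_gauge_iso.deriv_one \<phi>' (deriv_one a) = a"
proof -
  interpret inv: unital_gauge_iso \<phi>' \<phi> by (rule inverse_iso)
  have "(\<lambda>n. inv.quot (1/2^n) (quot (1/2^n) a)) \<longlonglongrightarrow> inv.deriv_one (deriv_one a)"
    using assms by (intro inv.quot_LIMSEQ deriv_one_LIMSEQ eventually_quot_sa deriv_one_sa)
  moreover have "\<forall>\<^sub>F n in sequentially. inv.quot (1/2^n) (quot (1/2^n) a) = a"
    using eventually_small[OF zero_less_one, of "norm a"]
  proof eventually_elim
    case (elim n)
    have "1 + (1/2^n) *\<^sub>R a \<in> ppos" using elim assms by (auto intro: ppos_one_plus)
    then have "\<phi>' (1 + (1/2^n) *\<^sub>R quot (1/2^n) a) = 1 + (1/2^n) *\<^sub>R a"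
      using isoD(2) map_one_plus[of "1/2^n" a] by fastforce
    then show ?case by (simp add: inv.quot_def)
  qed
  ultimately have "(\<lambda>n. a) \<longlonglongrightarrow> inv.deriv_one (deriv_one a)" by (rule Lim_transform_eventually)
  then show ?thesis by (simp add: LIMSEQ_const_iff)
qed

end

section \<open>Kadison's inequality\<close>

text \<open>Closed form: \<open>(n choose k) a\<^sup>k (1 - a)\<^sup>n\<^sup>-\<^sup>k\<close>. The recursion makes the moments computable
  without binomial identities.\<close>

fun bernstein_at :: "'a::unital_cstar_algebra \<Rightarrow> nat \<Rightarrow> nat \<Rightarrow> 'a" where
  "bernstein_at a 0 k = (if k = 0 then 1 else 0)"
| "bernstein_at a (Suc n) 0 = (1 - a) * bernstein_at a n 0"
| "bernstein_at a (Suc n) (Suc k) = (1 - a) * bernstein_at a n (Suc k) + a * bernstein_at a n k"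

lemma bernstein_at_commute:
  "w * a = a * w \<Longrightarrow> w * bernstein_at a n k = bernstein_at a n k * w"
proof (induction a n k rule: bernstein_at.induct)
  case (2 a n)
  have "w * (1 - a) = (1 - a) * w" using 2 by (simp add: algebra_simps)
  then show ?case using 2 by (metis bernstein_at.simps(2) mult.assoc)
next
  case (3 a n k)
  have c: "w * (1 - a) = (1 - a) * w" using 3 by (simp add: algebra_simps)
  have "w * ((1 - a) * bernstein_at a n (Suc k)) = (1 - a) * bernstein_at a n (Suc k) * w"
    using 3 c by (metis mult.assoc)
  moreover have "w * (a * bernstein_at a n k) = a * bernstein_at a n k * w" using 3 by (metis mult.assoc)
  ultimately show ?case by (simp add: distrib_left distrib_right)
qed simp

lemma pos_cone_mult:
  assumes "a \<in> pos_cone" "b \<in> pos_cone" "a * b = b * a" shows "a * b \<in> pos_cone"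
proof -
  obtain r where r: "r \<in> pos_cone" "r * r = a" "\<And>w. w * a = a * w \<Longrightarrow> w * r = r * w"
    using pos_cone_root[OF assms(1)] by blast
  have "b * r = r * b" using r(3) assms(3) by simp
  then have "a * b = r * b * r" using r(2) by (metis mult.assoc)
  then show ?thesis using pos_cone_conj[OF sa_pos_cone[OF r(1)] assms(2)] by simp
qed

lemma bernstein_at_pos:
  assumes "a \<in> pos_cone" "1 - a \<in> pos_cone" shows "bernstein_at a n k \<in> pos_cone"
  using assms
proof (induction a n k rule: bernstein_at.induct)
  case (2 a n)
  have "(1 - a) * bernstein_at a n 0 = bernstein_at a n 0 * (1 - a)"
    by (rule bernstein_at_commute) (simp add: algebra_simps)
  then show ?case using 2 by (simp add: pos_cone_mult)
next
  case (3 a n k)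
  have "(1 - a) * bernstein_at a n (Suc k) = bernstein_at a n (Suc k) * (1 - a)"
    "a * bernstein_at a n k = bernstein_at a n k * a"
    by (rule bernstein_at_commute, simp add: algebra_simps)+
  then show ?case using 3 by (simp add: pos_cone_mult pos_cone_add)
qed simp

lemma bernstein_at_beyond: "k > n \<Longrightarrow> bernstein_at a n k = 0"
  by (induction a n k rule: bernstein_at.induct) auto

text \<open>One step of the binomial walk: with weight \<open>1 - a\<close> the counter stays at
  \<open>k\<close>, with weight \<open>a\<close> it moves to \<open>k + 1\<close>.\<close>

lemma sum_bernstein_at_Suc:
  "(\<Sum>k\<le>Suc n. f k *\<^sub>R bernstein_at a (Suc n) k) =
   (1 - a) * (\<Sum>k\<le>n. f k *\<^sub>R bernstein_at a n k) + a * (\<Sum>k\<le>n. f (Suc k) *\<^sub>R bernstein_at a n k)"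
proof -
  have "(\<Sum>k\<le>Suc n. f k *\<^sub>R bernstein_at a (Suc n) k) =
      f 0 *\<^sub>R ((1 - a) * bernstein_at a n 0) +
      (\<Sum>k\<le>n. f (Suc k) *\<^sub>R ((1 - a) * bernstein_at a n (Suc k) + a * bernstein_at a n k))"
    by (simp add: sum.atMost_Suc_shift del: sum.atMost_Suc)
  also have "\<dots> = (1 - a) * (f 0 *\<^sub>R bernstein_at a n 0 + (\<Sum>k\<le>n. f (Suc k) *\<^sub>R bernstein_at a n (Suc k)))
      + a * (\<Sum>k\<le>n. f (Suc k) *\<^sub>R bernstein_at a n k)"
    by (simp add: distrib_left scaleR_add_right sum.distrib sum_distrib_left)
  also have "f 0 *\<^sub>R bernstein_at a n 0 + (\<Sum>k\<le>n. f (Suc k) *\<^sub>R bernstein_at a n (Suc k)) =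
      (\<Sum>k\<le>Suc n. f k *\<^sub>R bernstein_at a n k)"
    by (simp add: sum.atMost_Suc_shift del: sum.atMost_Suc)
  also have "\<dots> = (\<Sum>k\<le>n. f k *\<^sub>R bernstein_at a n k)" by (simp add: bernstein_at_beyond)
  finally show ?thesis .
qed

text \<open>Mass, mean and second moment of the binomial law, with \<open>a\<close> as the success
  probability.\<close>

lemma bernstein_at_moments:
  "(\<Sum>k\<le>n. bernstein_at a n k) = 1"
  "(\<Sum>k\<le>n. real k *\<^sub>R bernstein_at a n k) = real n *\<^sub>R a"
  "(\<Sum>k\<le>n. (real k)\<^sup>2 *\<^sub>R bernstein_at a n k) = (real n)\<^sup>2 *\<^sub>R (a * a) + real n *\<^sub>R (a - a * a)"
proof -
  show m0: "(\<Sum>k\<le>n. bernstein_at a n k) = 1" for n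
  proof (induction n)
    case (Suc n)
    then show ?case using sum_bernstein_at_Suc[of "\<lambda>_. 1" a n] by simp
  qed simp
  show m1: "(\<Sum>k\<le>n. real k *\<^sub>R bernstein_at a n k) = real n *\<^sub>R a" for n
  proof (induction n)
    case (Suc n)
    have "(\<Sum>k\<le>n. real (Suc k) *\<^sub>R bernstein_at a n k) = real n *\<^sub>R a + 1"
      using Suc m0[of n] by (simp add: scaleR_add_left sum.distrib add.commute)
    then show ?case
      unfolding sum_bernstein_at_Suc[of "\<lambda>k. real k"] Suc by (simp add: algebra_simps)
  qed simp
  show "(\<Sum>k\<le>n. (real k)\<^sup>2 *\<^sub>R bernstein_at a n k) = (real n)\<^sup>2 *\<^sub>R (a * a) + real n *\<^sub>R (a - a * a)"
  proof (induction n)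
    case (Suc n)
    have "(real (Suc k))\<^sup>2 *\<^sub>R b = (real k)\<^sup>2 *\<^sub>R b + 2 *\<^sub>R (real k *\<^sub>R b) + b" for k and b :: 'a
      by (simp add: power2_eq_square algebra_simps scaleR_2)
    then have eq: "(\<Sum>k\<le>n. (real (Suc k))\<^sup>2 *\<^sub>R bernstein_at a n k) =
        (real n)\<^sup>2 *\<^sub>R (a * a) + real n *\<^sub>R (a - a * a) + 2 *\<^sub>R (real n *\<^sub>R a) + 1"
      using Suc m0[of n] m1[of n] by (simp only: sum.distrib scaleR_sum_right[symmetric])
    show ?case
      unfolding sum_bernstein_at_Suc[of "\<lambda>k. (real k)\<^sup>2"] Suc eq
      by (simp add: algebra_simps power2_eq_square scaleR_2)
  qed simp
qed

lemma sum_pos_cone: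
  assumes "finite I" "\<And>i. i \<in> I \<Longrightarrow> x i \<in> pos_cone" shows "(\<Sum>i\<in>I. x i) \<in> pos_cone"
  using assms by (induction I rule: finite_induct) auto

context unital_gauge_iso
begin

lemma deriv_one_sum:
  assumes "finite I" "\<And>i. i \<in> I \<Longrightarrow> selfadjoint (x i)"
  shows "selfadjoint (\<Sum>i\<in>I. x i) \<and> deriv_one (\<Sum>i\<in>I. x i) = (\<Sum>i\<in>I. deriv_one (x i))"
  using assms by (induction I rule: finite_induct) (simp_all add: deriv_one_add)

text \<open>Kadison's inequality: the \<open>deriv_one p\<^sub>k\<close> for the Bernstein polynomials \<open>p\<^sub>k\<close> are positive and sum to
  \<open>1\<close>, and the variance \<open>\<Sum> (k/n - d) deriv_one p\<^sub>k (k/n - d)\<close> about the mean \<open>d = deriv_one a\<close>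
  is positive.\<close>

lemma kadison_unit_interval:
  assumes a: "a \<in> pos_cone" "1 - a \<in> pos_cone"
  shows "deriv_one a * deriv_one a \<preceq> deriv_one (a * a)"
proof -
  have sa: "selfadjoint a" using a sa_pos_cone by auto
  define d where "d = deriv_one a"
  have sd: "selfadjoint d" using deriv_one_sa sa by (simp add: d_def)
  \<comment> \<open>The term \<open>(1/n) D (a - a^2)\<close>, with \<open>D\<close> for
    \<open>deriv_one\<close>, is the image of the binomial variance divided by \<open>n^2\<close>;
    it vanishes in the limit.\<close>
  have main: "deriv_one (a * a) + (1/real n) *\<^sub>R deriv_one (a - a * a) - d * d \<in> pos_cone" if n: "n > 0" for n
  proof -
    define p where "p k = bernstein_at a n k" for k
    define P where "P k = deriv_one (p k)" for k
    have p: "p k \<in> pos_cone" "selfadjoint (p k)" for k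
      using bernstein_at_pos[OF a] sa_pos_cone by (auto simp: p_def)
    have P: "P k \<in> pos_cone" for k using p deriv_one_pos by (simp add: P_def)
    have lin: "(\<Sum>k\<le>n. f k *\<^sub>R P k) = deriv_one (\<Sum>k\<le>n. f k *\<^sub>R p k)" for f
      using deriv_one_sum[of "{..n}" "\<lambda>k. f k *\<^sub>R p k"] p by (simp add: P_def deriv_one_scaleR)
    have m0: "(\<Sum>k\<le>n. P k) = 1"
      using lin[of "\<lambda>_. 1"] bernstein_at_moments(1)[of a n] deriv_one_one by (simp add: p_def)
    have m1: "(\<Sum>k\<le>n. (real k / real n) *\<^sub>R P k) = d"
    proof -
      have "(\<Sum>k\<le>n. real k *\<^sub>R P k) = real n *\<^sub>R d"
        using lin[of real] bernstein_at_moments(2)[of a n] deriv_one_scaleR[OF sa] by (simp add: p_def d_def)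
      then have "(1/real n) *\<^sub>R (\<Sum>k\<le>n. real k *\<^sub>R P k) = d" using n by simp
      then show ?thesis by (simp add: scaleR_sum_right)
    qed
    have m2: "(\<Sum>k\<le>n. ((real k / real n)\<^sup>2) *\<^sub>R P k) = deriv_one (a * a) + (1/real n) *\<^sub>R deriv_one (a - a * a)"
    proof -
      have "(\<Sum>k\<le>n. (real k)\<^sup>2 *\<^sub>R P k) = (real n)\<^sup>2 *\<^sub>R deriv_one (a * a) + real n *\<^sub>R deriv_one (a - a * a)"
        using lin[of "\<lambda>k. (real k)\<^sup>2"] bernstein_at_moments(3)[of a n] sa
        by (simp add: p_def deriv_one_scaleR deriv_one_add)
      then have "(1/(real n)\<^sup>2) *\<^sub>R (\<Sum>k\<le>n. (real k)\<^sup>2 *\<^sub>R P k) = deriv_one (a * a) + (1/real n) *\<^sub>R deriv_one (a - a * a)"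
        using n by (simp add: scaleR_add_right power2_eq_square)
      then show ?thesis by (simp add: scaleR_sum_right power_divide)
    qed
    have expand: "((real k / real n) *\<^sub>R 1 - d) * P k * ((real k / real n) *\<^sub>R 1 - d) =
      ((real k / real n)\<^sup>2) *\<^sub>R P k - ((real k / real n) *\<^sub>R P k) * d - d * ((real k / real n) *\<^sub>R P k) + d * P k * d" for k
      by (simp add: algebra_simps power2_eq_square)
    have "(\<Sum>k\<le>n. ((real k / real n) *\<^sub>R 1 - d) * P k * ((real k / real n) *\<^sub>R 1 - d)) =
      (\<Sum>k\<le>n. ((real k / real n)\<^sup>2) *\<^sub>R P k) - (\<Sum>k\<le>n. (real k / real n) *\<^sub>R P k) * d
      - d * (\<Sum>k\<le>n. (real k / real n) *\<^sub>R P k) + d * (\<Sum>k\<le>n. P k) * d"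
      unfolding expand sum.distrib sum_subtractf sum_distrib_left sum_distrib_right ..
    also have "\<dots> = deriv_one (a * a) + (1/real n) *\<^sub>R deriv_one (a - a * a) - d * d"
      unfolding m0 m1 m2 by simp
    finally show ?thesis
      using sum_pos_cone[of "{..n}" "\<lambda>k. ((real k / real n) *\<^sub>R 1 - d) * P k * ((real k / real n) *\<^sub>R 1 - d)"]
        pos_cone_conj[OF _ P] sd by simp
  qed
  have "(\<lambda>n. deriv_one (a * a) + (1/real (Suc n)) *\<^sub>R deriv_one (a - a * a) - d * d)
      \<longlonglongrightarrow> deriv_one (a * a) + 0 *\<^sub>R deriv_one (a - a * a) - d * d"
    using LIMSEQ_inverse_real_of_nat by (intro tendsto_intros) (simp add: inverse_eq_divide)
  then have "deriv_one (a * a) + 0 *\<^sub>R deriv_one (a - a * a) - d * d \<in> pos_cone"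
    by (rule pos_cone_limit) (use main in blast)
  then show ?thesis using sa sd by (intro cleI) (simp_all add: deriv_one_sa d_def)
qed

text \<open>An affine change of variable brings \<open>a\<close> into the unit interval. The defect
  \<open>D (a^2) - (D a)^2\<close> ignores the shift and scales by the square of the factor.\<close>

lemma kadison:
  assumes a: "selfadjoint a" shows "deriv_one a * deriv_one a \<preceq> deriv_one (a * a)"
proof -
  \<comment> \<open>The summand \<open>1\<close> keeps \<open>R\<close> positive when
    \<open>a = 0\<close>.\<close>
  define R where "R = norm a + 1"
  have R: "R > 0" "norm a \<le> R" by (simp_all add: R_def add_nonneg_pos)
  define b where "b = (1/(2*R)) *\<^sub>R (a + R *\<^sub>R 1)"
  have sb: "selfadjoint b" using a by (simp add: b_def)
  have "a + R *\<^sub>R 1 \<in> pos_cone" using cle_sa(3)[OF cle_minus_norm[OF a R(2)]] by simp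
  then have b1: "b \<in> pos_cone" using R by (auto simp: b_def)
  have "1 - b = (1/(2*R)) *\<^sub>R (R *\<^sub>R 1 - a)"
    using R by (simp add: b_def scaleR_diff_right scaleR_add_right)
      (simp add: scaleR_half_double[symmetric] scaleR_add_left[symmetric] algebra_simps)
  moreover have "R *\<^sub>R 1 - a \<in> pos_cone" using cle_sa(3)[OF cle_norm[OF a R(2)]] by simp
  ultimately have b2: "1 - b \<in> pos_cone" using R by auto
  have ab: "a = (2*R) *\<^sub>R b - R *\<^sub>R 1" using R by (simp add: b_def)
  have da: "deriv_one a = (2*R) *\<^sub>R deriv_one b - R *\<^sub>R 1"
    unfolding ab using sb by (simp add: deriv_one_diff deriv_one_scaleR deriv_one_one)
  have "a * a = (2*R)\<^sup>2 *\<^sub>R (b * b) - (4*R*R) *\<^sub>R b + (R*R) *\<^sub>R 1"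
    unfolding ab by (simp add: algebra_simps power2_eq_square scaleR_add_left[symmetric])
  then have daa: "deriv_one (a * a) = (2*R)\<^sup>2 *\<^sub>R deriv_one (b * b) - (4*R*R) *\<^sub>R deriv_one b + (R*R) *\<^sub>R 1"
    using sb by (simp add: deriv_one_diff deriv_one_add deriv_one_scaleR deriv_one_one)
  have "deriv_one a * deriv_one a = (2*R)\<^sup>2 *\<^sub>R (deriv_one b * deriv_one b) - (4*R*R) *\<^sub>R deriv_one b + (R*R) *\<^sub>R 1"
    unfolding da by (simp add: algebra_simps power2_eq_square scaleR_add_left[symmetric])
  then have "deriv_one (a * a) - deriv_one a * deriv_one a =
      (2*R)\<^sup>2 *\<^sub>R (deriv_one (b * b) - deriv_one b * deriv_one b)"
    unfolding daa by (simp add: scaleR_diff_right)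
  moreover have "deriv_one (b * b) - deriv_one b * deriv_one b \<in> pos_cone"
    using kadison_unit_interval[OF b1 b2] by (rule cle_sa)
  ultimately have "deriv_one (a * a) - deriv_one a * deriv_one a \<in> pos_cone" by auto
  then show ?thesis using a by (intro cleI) (simp_all add: deriv_one_sa)
qed

lemma deriv_one_mono:
  assumes "a \<preceq> b" shows "deriv_one a \<preceq> deriv_one b"
  using deriv_one_pos[OF cle_sa(3)[OF assms]] cle_sa[OF assms] deriv_one_diff[of b a]
  by (intro cleI) (simp_all add: deriv_one_sa)

lemma deriv_one_sq:
  assumes a: "selfadjoint a" shows "deriv_one (a * a) = deriv_one a * deriv_one a"
proof (rule cle_antisym)
  interpret inv: unital_gauge_iso \<phi>' \<phi> by (rule inverse_iso)
  have sd: "selfadjoint (deriv_one a)" using a by (rule deriv_one_sa)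
  have "a * a \<preceq> inv.deriv_one (deriv_one a * deriv_one a)"
    using inv.kadison[OF sd] a by (simp add: deriv_one_inverse)
  then have "deriv_one (a * a) \<preceq> deriv_one (inv.deriv_one (deriv_one a * deriv_one a))"
    by (rule deriv_one_mono)
  then show "deriv_one (a * a) \<preceq> deriv_one a * deriv_one a"
    using inv.deriv_one_inverse[of "deriv_one a * deriv_one a"] sd by simp
qed (rule kadison[OF a])

end

section \<open>Linearity and the Jordan isomorphism\<close>

lemma norm_le_of_pos_cle:
  assumes "p \<in> pos_cone" "p \<preceq> t *\<^sub>R 1" "t \<ge> 0" shows "norm p \<le> t"
proof (rule norm_le_of_cle)
  have "(- t) *\<^sub>R 1 \<preceq> 0" using cle_scaleR_left[OF pos_cone_1, of "- t" 0] assms by simp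
  also have "0 \<preceq> p" using assms by simp
  finally show "(- t) *\<^sub>R 1 \<preceq> p" .
qed (use assms in auto)

lemma ppos_cstar_sqrt:
  assumes "x \<in> ppos" shows "cstar_sqrt x \<in> ppos" "cstar_sqrt x * cstar_sqrt x = x"
proof -
  obtain r where "r \<in> ppos" "r * r = x" using ppos_root assms by blast
  moreover from this have "cstar_sqrt x = r" by (intro cstar_sqrt_eq) auto
  ultimately show "cstar_sqrt x \<in> ppos" "cstar_sqrt x * cstar_sqrt x = x" by auto
qed

text \<open>The case of operator monotonicity of the root used below:
  \<open>(norm (cinv v))^2 = norm (cinv (v * v)) \<le> 1\<close>, and inversion reverses
  \<open>cinv v \<preceq> 1\<close>.\<close>

lemma one_cle_root:
  assumes v: "v \<in> ppos" and le: "1 \<preceq> v * v" shows "1 \<preceq> v"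
proof -
  have "cinv (v * v) = cinv v * cinv v" using cinv_conj[of v 1] v by simp
  then have "cinv v * cinv v \<preceq> 1 *\<^sub>R 1" using cinv_antimono[of 1 "v * v"] v le by simp
  then have "norm (cinv v * cinv v) \<le> 1" using v by (intro norm_le_of_pos_cle) auto
  then have "norm (cinv v) \<le> 1" using v by (simp add: sa_norm_sq power_le_one_iff abs_square_le_1)
  then have "cinv v \<preceq> 1" using cle_norm[of "cinv v" 1] v by simp
  then show ?thesis using cinv_antimono[of "cinv v" 1] v by simp
qed

lemma norm_diff_sq_le:
  fixes x y :: "'a::real_normed_algebra"
  assumes "norm x \<le> B" "norm y \<le> B"
  shows "norm (x * x - y * y) \<le> norm (x - y) * (2 * B)"
proof -
  have "x * x - y * y = x * (x - y) + (x - y) * y" by (simp add: algebra_simps)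
  then have "norm (x * x - y * y) \<le> norm x * norm (x - y) + norm (x - y) * norm y"
    using norm_triangle_ineq[of "x * (x - y)" "(x - y) * y"] norm_mult_ineq[of x "x - y"]
      norm_mult_ineq[of "x - y" y] by simp
  also have "\<dots> \<le> B * norm (x - y) + norm (x - y) * B"
    using assms by (intro add_mono mult_right_mono mult_left_mono) auto
  finally show ?thesis by (simp add: algebra_simps)
qed

context unital_gauge_iso
begin

text \<open>Write \<open>a = (1 + b\<^sub>n/2\<^sup>n)\<^bsup>2\<^sup>n\<^esup>\<close> with \<open>0 \<le> b\<^sub>n \<le> a - 1\<close>. Both \<open>\<phi>\<close> and its derivative at \<open>1\<close> commute
  with squaring, and they agree at \<open>1 + b\<^sub>n/2\<^sup>n\<close> up to order \<open>4\<^sup>-\<^sup>n\<close>, which beats the factor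
  \<open>O(2\<^sup>n)\<close> lost by squaring \<open>n\<close> times.\<close>

lemma map_eq_deriv_one_ge_one:
  assumes a: "1 \<preceq> a" shows "\<phi> a = deriv_one a"
proof -
  have ap: "a \<in> ppos" using a ppos_cle ppos_1 by blast
  define r where "r n = (cstar_sqrt ^^ n) a" for n
  have r0: "r 0 = a" by (simp add: r_def)
  have rp: "r n \<in> ppos" for n by (induction n) (simp_all add: r_def ap ppos_cstar_sqrt)
  have rr: "r (Suc n) * r (Suc n) = r n" for n using ppos_cstar_sqrt(2)[OF rp[of n]] by (simp add: r_def)
  have r1: "1 \<preceq> r n" for n
  proof (induction n)
    case (Suc n)
    then show ?case using one_cle_root[OF rp[of "Suc n"]] rr[of n] by simp
  qed (simp add: r0 a)
  define b where "b n = 2^n *\<^sub>R (r n - 1)" for n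
  have bp: "b n \<in> pos_cone" for n using cle_sa(3)[OF r1[of n]] by (auto simp: b_def)
  have bs: "selfadjoint (b n)" for n using bp sa_pos_cone by blast
  have rb: "r n = 1 + (1/2^n) *\<^sub>R b n" for n by (simp add: b_def)
  define R where "R = norm (a - 1)"
  have R: "R \<ge> 0" by (simp add: R_def)
  \<comment> \<open>Passing from \<open>r n = v^2\<close> to \<open>v\<close> lowers
    \<open>b\<close> by \<open>2^n (v - 1)^2\<close>. Since \<open>1 \<preceq> a\<close> makes all
    \<open>b n\<close> positive, this order bound becomes a norm bound.\<close>
  have "b n \<preceq> a - 1" for n
  proof (induction n)
    case 0
    then show ?case using ap by (simp add: b_def r0)
  next
    case (Suc n)
    let ?v = "r (Suc n)"
    have "b n - b (Suc n) = 2^n *\<^sub>R (?v * ?v - 1) - 2^n *\<^sub>R 2 *\<^sub>R (?v - 1)"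
      by (simp add: b_def rr mult.commute)
    also have "\<dots> = 2^n *\<^sub>R ((?v - 1) * (?v - 1))"
      by (simp only: scaleR_diff_right[symmetric]) (simp add: algebra_simps scaleR_2)
    finally have "b n - b (Suc n) \<in> pos_cone" using pos_cone_sq[of "?v - 1"] rp by auto
    then have "b (Suc n) \<preceq> b n" using bs by (intro cleI) auto
    then show ?case using Suc cle_trans by blast
  qed
  then have "b n \<preceq> R *\<^sub>R 1" for n using cle_trans cle_norm[of "a - 1" R] ap by (simp add: R_def) blast
  then have bR: "norm (b n) \<le> R" for n using norm_le_of_pos_cle[OF bp] R by blast
  define e where "e n = norm (\<phi> (r n) - deriv_one (r n))" for n
  have B: "norm (\<phi> (r n)) \<le> 1 + R/2^n" "norm (deriv_one (r n)) \<le> 1 + R/2^n" for n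
  proof -
    have c: "0 < 1 + R/2^n" using R by (simp add: add_pos_nonneg)
    have le: "r n \<preceq> (1 + R/2^n) *\<^sub>R 1"
      using one_plus_bounds(1)[OF bs[of n], of "1/2^n" R] bR by (simp add: rb[symmetric])
    then have "\<phi> (r n) \<preceq> (1 + R/2^n) *\<^sub>R 1" using mono[OF rp ppos_scaleR[OF ppos_1 c]] c by (simp add: map_scalar)
    then show "norm (\<phi> (r n)) \<le> 1 + R/2^n" using c isoD(1)[OF rp] by (intro norm_le_of_pos_cle) auto
    have "norm (r n) \<le> 1 + R/2^n" using c rp le by (intro norm_le_of_pos_cle) auto
    then show "norm (deriv_one (r n)) \<le> 1 + R/2^n" using deriv_one_norm[of "r n"] rp by force
  qed
  have step: "e n \<le> e (Suc n) * (2 * (1 + R/2^Suc n))" for n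
  proof -
    have "\<phi> (r n) = \<phi> (r (Suc n)) * \<phi> (r (Suc n))" using map_sq[OF rp[of "Suc n"]] by (simp add: rr)
    moreover have "deriv_one (r n) = deriv_one (r (Suc n)) * deriv_one (r (Suc n))"
      using deriv_one_sq[of "r (Suc n)"] rp by (simp add: rr)
    ultimately show ?thesis unfolding e_def using norm_diff_sq_le[OF B(1)[of "Suc n"] B(2)[of "Suc n"]] by (simp only:)
  qed
  \<comment> \<open>The product of the factors \<open>1 + R/2^k\<close> for
    \<open>k = 1, ..., n\<close> is at most \<open>exp (R * (1 - 1/2^n))\<close>, the exponent being
    a geometric sum; beyond \<open>2^n\<close>, squaring back costs only a constant.\<close>
  have acc: "e 0 \<le> 2^n * exp (R * (1 - 1/2^n)) * e n" for n
  proof (induction n)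
    case (Suc n)
    have "e (Suc n) * (2 * (1 + R/2^Suc n)) \<le> e (Suc n) * (2 * exp (R/2^Suc n))"
      by (intro mult_left_mono exp_ge_add_one_self) (simp_all add: e_def)
    with step[of n] have "e n \<le> e (Suc n) * (2 * exp (R/2^Suc n))" by (rule order_trans)
    then have "2^n * exp (R * (1 - 1/2^n)) * e n \<le> 2^n * exp (R * (1 - 1/2^n)) * (e (Suc n) * (2 * exp (R/2^Suc n)))"
      by (intro mult_left_mono) auto
    also have "\<dots> = 2^Suc n * (exp (R * (1 - 1/2^n)) * exp (R/2^Suc n)) * e (Suc n)" by simp
    also have "exp (R * (1 - 1/2^n)) * exp (R/2^Suc n) = exp (R * (1 - 1/2^Suc n))"
      unfolding exp_add[symmetric] by (simp add: field_simps)
    finally show ?case using Suc by linarith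
  qed simp
  have "\<forall>\<^sub>F n in sequentially. e 0 \<le> exp R * 2 * R\<^sup>2 * (1/2)^n"
    using eventually_small[of "1/4" R, OF divide_pos_pos[OF zero_less_one zero_less_numeral]]
  proof eventually_elim
    case (elim n)
    have "\<phi> (r n) - deriv_one (r n) = (1/2^n) *\<^sub>R (quot (1/2^n) (b n) - deriv_one (b n))"
      using map_one_plus[of "1/2^n" "b n"] bs[of n]
      by (simp add: rb deriv_one_add deriv_one_scaleR deriv_one_one scaleR_diff_right)
    then have "e n = (1/2^n) * norm (quot (1/2^n) (b n) - deriv_one (b n))" by (simp add: e_def)
    also have "\<dots> \<le> (1/2^n) * (2 * R\<^sup>2 / 2^n)"
      using quot_deriv_one_bound(2)[OF bs bR, of n n] elim by (intro mult_left_mono) auto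
    finally have en: "e n \<le> (1/2^n) * (2 * R\<^sup>2 / 2^n)" .
    have "exp (R * (1 - 1/2^n)) \<le> exp R" using R by (simp add: mult_left_le)
    then have "2^n * exp (R * (1 - 1/2^n)) * e n \<le> 2^n * exp R * ((1/2^n) * (2 * R\<^sup>2 / 2^n))"
      using en by (intro mult_mono) (auto simp: e_def)
    also have "\<dots> = exp R * 2 * R\<^sup>2 * (1/2)^n" by (simp add: power_one_over)
    finally show ?case using acc[of n] by linarith
  qed
  moreover have "(\<lambda>n. exp R * 2 * R\<^sup>2 * (1/2)^n) \<longlonglongrightarrow> exp R * 2 * R\<^sup>2 * 0"
    by (intro tendsto_intros LIMSEQ_power_zero) simp
  ultimately have "e 0 \<le> exp R * 2 * R\<^sup>2 * 0" by (intro tendsto_lowerbound) auto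
  then show ?thesis by (simp add: e_def r0)
qed

lemma map_eq_deriv_one:
  assumes "a \<in> ppos" shows "\<phi> a = deriv_one a"
proof -
  obtain \<delta> where d: "\<delta> > 0" "\<delta> *\<^sub>R 1 \<preceq> a" using assms ppos_iff by blast
  have "1 \<preceq> (1/\<delta>) *\<^sub>R a" using cle_scaleR[OF d(2), of "1/\<delta>"] d(1) by simp
  then have "\<phi> ((1/\<delta>) *\<^sub>R a) = deriv_one ((1/\<delta>) *\<^sub>R a)" by (rule map_eq_deriv_one_ge_one)
  then show ?thesis using d assms by (simp add: homogeneous deriv_one_scaleR)
qed

end

section \<open>Complex extension of the derivative\<close>

definition re_part :: "'a::unital_cstar_algebra \<Rightarrow> 'a"
  where "re_part z = (1/2) *\<^sub>R (z + star z)"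

definition im_part :: "'a::unital_cstar_algebra \<Rightarrow> 'a"
  where "im_part z = - ((1/2) *\<^sub>R (\<i> *\<^sub>C (z - star z)))"

lemma sa_re_part [simp]: "selfadjoint (re_part z)"
  by (simp add: re_part_def selfadjoint_def star_add star_star add.commute)

lemma sa_im_part [simp]: "selfadjoint (im_part z)"
  by (simp add: im_part_def selfadjoint_def star_scaleC_i star_star scaleC_diff_right)

lemma re_im_part: "re_part z + \<i> *\<^sub>C im_part z = z"
proof -
  have "\<i> *\<^sub>C im_part z = (1/2) *\<^sub>R (z - star z)"
    by (simp add: im_part_def scaleC_minus_right scaleC_scaleR scaleC_i_i scaleR_diff_right)
  then show ?thesis by (simp add: re_part_def scaleR_add_right[symmetric] scaleR_2[symmetric])
qed

lemma cartesian_cases: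
  obtains x y where "selfadjoint x" "selfadjoint y" "z = x + \<i> *\<^sub>C y"
  using re_im_part[of z] sa_re_part sa_im_part by metis

lemma re_im_part_eq:
  assumes "selfadjoint x" "selfadjoint y"
  shows "re_part (x + \<i> *\<^sub>C y) = x" "im_part (x + \<i> *\<^sub>C y) = y"
proof -
  have s: "star (x + \<i> *\<^sub>C y) = x - \<i> *\<^sub>C y" using assms by (simp add: star_add star_scaleC_i sa_star)
  show "re_part (x + \<i> *\<^sub>C y) = x" unfolding re_part_def s by (simp add: scaleR_2[symmetric])
  have "x + \<i> *\<^sub>C y - (x - \<i> *\<^sub>C y) = 2 *\<^sub>R \<i> *\<^sub>C y" by (simp add: scaleR_2)
  then show "im_part (x + \<i> *\<^sub>C y) = y" unfolding im_part_def s by (simp add: scaleC_scaleR scaleC_i_i)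
qed

lemma sa_jordan_prod [simp]: "selfadjoint x \<Longrightarrow> selfadjoint y \<Longrightarrow> selfadjoint (jordan_prod x y)"
  by (simp add: jordan_prod_def selfadjoint_def star_add star_mult add.commute)

lemma jordan_prod_cartesian:
  "jordan_prod (x + \<i> *\<^sub>C y) (u + \<i> *\<^sub>C v) =
   (jordan_prod x u - jordan_prod y v) + \<i> *\<^sub>C (jordan_prod x v + jordan_prod y u)"
  by (simp add: jordan_prod_def algebra_simps mult_scaleC_left mult_scaleC_right scaleC_i_i
      scaleC_add_right scaleC_scaleR scaleR_add_right)

lemma scaleC_cartesian:
  "c *\<^sub>C (x + \<i> *\<^sub>C y) = (Re c *\<^sub>R x - Im c *\<^sub>R y) + \<i> *\<^sub>C (Im c *\<^sub>R x + Re c *\<^sub>R (y::'a::unital_cstar_algebra))"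
proof -
  have "c *\<^sub>C (x + \<i> *\<^sub>C y) = Re c *\<^sub>R (x + \<i> *\<^sub>C y) + \<i> *\<^sub>C Im c *\<^sub>R (x + \<i> *\<^sub>C y)" by (rule scaleC_complex)
  also have "\<dots> = (Re c *\<^sub>R x - Im c *\<^sub>R y) + \<i> *\<^sub>C (Im c *\<^sub>R x + Re c *\<^sub>R y)"
    by (simp add: scaleR_add_right scaleC_add_right scaleC_scaleR scaleC_i_i)
  finally show ?thesis .
qed

context unital_gauge_iso
begin

definition jordan_ext :: "'a \<Rightarrow> 'b"
  where "jordan_ext z = deriv_one (re_part z) + \<i> *\<^sub>C deriv_one (im_part z)"

lemma jordan_ext_cartesian:
  "selfadjoint x \<Longrightarrow> selfadjoint y \<Longrightarrow> jordan_ext (x + \<i> *\<^sub>C y) = deriv_one x + \<i> *\<^sub>C deriv_one y"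
  by (simp add: jordan_ext_def re_im_part_eq)

lemma jordan_ext_sa: "selfadjoint x \<Longrightarrow> jordan_ext x = deriv_one x"
  using jordan_ext_cartesian[of x 0] by simp

lemma jordan_ext_inverse: "unital_gauge_iso.jordan_ext \<phi>' (jordan_ext z) = z"
proof -
  interpret inv: unital_gauge_iso \<phi>' \<phi> by (rule inverse_iso)
  obtain x y where z: "selfadjoint x" "selfadjoint y" "z = x + \<i> *\<^sub>C y" by (rule cartesian_cases)
  then show ?thesis
    by (simp add: jordan_ext_cartesian inv.jordan_ext_cartesian deriv_one_sa deriv_one_inverse)
qed

text \<open>Polarisation reduces the Jordan product to squares.\<close>

lemma deriv_one_jordan_prod:
  assumes "selfadjoint x" "selfadjoint y"
  shows "deriv_one (jordan_prod x y) = jordan_prod (deriv_one x) (deriv_one y)"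
proof -
  have polar: "jordan_prod u v = (1/2) *\<^sub>R ((u + v) * (u + v) - u * u - v * v)"
    for u v :: "'c::unital_cstar_algebra"
    by (simp add: jordan_prod_def algebra_simps)
  have "deriv_one (jordan_prod x y) =
      (1/2) *\<^sub>R (deriv_one ((x + y) * (x + y)) - deriv_one (x * x) - deriv_one (y * y))"
    unfolding polar using assms by (simp only: deriv_one_scaleR deriv_one_diff sa_diff sa_sq sa_add)
  also have "\<dots> = jordan_prod (deriv_one x) (deriv_one y)"
    unfolding polar using assms by (simp only: deriv_one_sq deriv_one_add sa_add)
  finally show ?thesis .
qed

lemma jordan_star_iso_jordan_ext: "jordan_star_iso jordan_ext"
  unfolding jordan_star_iso_def
proof (intro conjI allI)
  interpret inv: unital_gauge_iso \<phi>' \<phi> by (rule inverse_iso)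
  show "bij jordan_ext"
    by (rule o_bij[of "inv.jordan_ext"]) (simp_all add: fun_eq_iff jordan_ext_inverse inv.jordan_ext_inverse)
  fix z w :: 'a and c :: complex
  obtain x y where z: "selfadjoint x" "selfadjoint y" "z = x + \<i> *\<^sub>C y" by (rule cartesian_cases)
  obtain u v where w: "selfadjoint u" "selfadjoint v" "w = u + \<i> *\<^sub>C v" by (rule cartesian_cases)
  have "z + w = (x + u) + \<i> *\<^sub>C (y + v)" by (simp add: z w scaleC_add_right)
  then have "jordan_ext (z + w) = deriv_one (x + u) + \<i> *\<^sub>C deriv_one (y + v)"
    using z w by (simp only: jordan_ext_cartesian sa_add)
  then show "jordan_ext (z + w) = jordan_ext z + jordan_ext w"
    using z w by (simp add: jordan_ext_cartesian deriv_one_add scaleC_add_right)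
  have "jordan_ext (c *\<^sub>C z) = deriv_one (Re c *\<^sub>R x - Im c *\<^sub>R y) + \<i> *\<^sub>C deriv_one (Im c *\<^sub>R x + Re c *\<^sub>R y)"
    unfolding z(3) scaleC_cartesian using z(1,2) by (intro jordan_ext_cartesian) auto
  also have "\<dots> = c *\<^sub>C jordan_ext z"
    unfolding z(3) jordan_ext_cartesian[OF z(1,2)] scaleC_cartesian
    using z(1,2) by (simp add: deriv_one_add deriv_one_diff deriv_one_scaleR)
  finally show "jordan_ext (c *\<^sub>C z) = c *\<^sub>C jordan_ext z" .
  have "jordan_ext (jordan_prod z w) = deriv_one (jordan_prod x u - jordan_prod y v) +
      \<i> *\<^sub>C deriv_one (jordan_prod x v + jordan_prod y u)"
    unfolding z(3) w(3) jordan_prod_cartesian using z(1,2) w(1,2) by (intro jordan_ext_cartesian) auto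
  also have "\<dots> = jordan_prod (jordan_ext z) (jordan_ext w)"
    unfolding z(3) w(3) jordan_ext_cartesian[OF z(1,2)] jordan_ext_cartesian[OF w(1,2)] jordan_prod_cartesian
    using z(1,2) w(1,2) by (simp add: deriv_one_add deriv_one_diff deriv_one_jordan_prod)
  finally show "jordan_ext (jordan_prod z w) = jordan_prod (jordan_ext z) (jordan_ext w)" .
  have "star z = x + \<i> *\<^sub>C (- y)"
    using z by (simp add: star_add star_scaleC_i sa_star scaleC_minus_right)
  then have "jordan_ext (star z) = deriv_one x + \<i> *\<^sub>C deriv_one (- y)"
    using z(1,2) by (simp only: jordan_ext_cartesian sa_minus)
  also have "\<dots> = star (jordan_ext z)"
    unfolding z(3) jordan_ext_cartesian[OF z(1,2)]
    using z(1,2) by (simp add: deriv_one_minus star_add star_scaleC_i deriv_one_sa sa_star scaleC_minus_right)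
  finally show "jordan_ext (star z) = star (jordan_ext z)" .
qed

end

section \<open>From invertible elements to the whole cone\<close>

lemma pos_cone_add_ppos: "p \<in> pos_cone \<Longrightarrow> q \<in> ppos \<Longrightarrow> p + q \<in> ppos"
  by (rule ppos_cle[of q], assumption, rule cleI) (simp_all add: sa_pos_cone)

lemma cle_conj_iff:
  assumes "c \<in> ppos" "selfadjoint x" "selfadjoint y"
  shows "c * x * c \<preceq> c * y * c \<longleftrightarrow> x \<preceq> y"
proof
  assume "c * x * c \<preceq> c * y * c"
  then have "cinv c * (c * x * c) * cinv c \<preceq> cinv c * (c * y * c) * cinv c"
    by (rule cle_conj) (use assms in simp)
  then show "x \<preceq> y" using assms by (simp add: mult.assoc cinv cinv_cancel)
qed (use assms in \<open>simp add: cle_conj\<close>)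

text \<open>Closedness of the cone takes the place of continuity of \<open>\<phi>\<close> at the
  boundary, which is not known.\<close>

lemma cle_add_small:
  assumes "selfadjoint y" "h \<in> pos_cone" "\<And>\<epsilon>. \<epsilon> > 0 \<Longrightarrow> x \<preceq> y + \<epsilon> *\<^sub>R h" shows "x \<preceq> y"
proof -
  have "(\<lambda>n. y + (1/real (Suc n)) *\<^sub>R h) \<longlonglongrightarrow> y + 0 *\<^sub>R h"
    using LIMSEQ_inverse_real_of_nat by (intro tendsto_intros) (simp add: inverse_eq_divide)
  then have "x \<preceq> y + 0 *\<^sub>R h" by (rule cle_limit[OF tendsto_const]) (use assms in simp)
  then show ?thesis by simp
qed

theorem theorem5p1:
  fixes \<phi> :: "'a::unital_cstar_algebra \<Rightarrow> 'b::unital_cstar_algebra"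
  assumes "bij_betw \<phi> pos_cone pos_cone"
    and "\<And>(x::'a) (t::real). x \<in> pos_cone \<Longrightarrow> 0 \<le> t \<Longrightarrow> \<phi> (t *\<^sub>R x) = t *\<^sub>R \<phi> x"
    and "\<And>x x'::'a. x \<in> pos_cone \<Longrightarrow> x' \<in> pos_cone \<Longrightarrow> x \<preceq> x' \<longleftrightarrow> \<phi> x \<preceq> \<phi> x'"
  shows "\<exists>J :: 'a \<Rightarrow> 'b. jordan_star_iso J \<and>
    (\<forall>x \<in> pos_cone. \<phi> x = cstar_sqrt (\<phi> 1) * J x * cstar_sqrt (\<phi> 1))"
proof -
  note hom = assms(2) and ord = assms(3)
  define \<phi>i where "\<phi>i = inv_into pos_cone \<phi>"
  have \<phi>p: "\<phi> x \<in> pos_cone" "\<phi>i (\<phi> x) = x" if "x \<in> pos_cone" for x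
    using assms(1) that by (auto simp: \<phi>i_def bij_betw_def)
  have \<phi>ip: "\<phi>i y \<in> pos_cone" "\<phi> (\<phi>i y) = y" if "y \<in> pos_cone" for y
    using assms(1) that bij_betwE[OF bij_betw_inv_into[OF assms(1)]]
    by (auto simp: \<phi>i_def bij_betw_inv_into_right)
  define h where "h = \<phi> 1"
  have hp: "h \<in> ppos"
  proof -
    \<comment> \<open>By surjectivity \<open>1\<close> has a preimage, which lies below some
      \<open>t\<close>; so \<open>1 \<preceq> t h\<close>, and \<open>h\<close> is
      invertible.\<close>
    define x where "x = \<phi>i 1"
    have x: "x \<in> pos_cone" "\<phi> x = 1" using \<phi>ip by (simp_all add: x_def)
    obtain t where t: "t > 0" "x \<preceq> t *\<^sub>R 1" using ppos_dominates[of x 1] x sa_pos_cone by auto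
    then have "1 \<preceq> t *\<^sub>R h" using ord[of x "t *\<^sub>R 1"] x hom[of 1 t] by (simp add: h_def pos_cone_scaleR)
    then have "(1/t) *\<^sub>R 1 \<preceq> h" using cle_scaleR[of 1 "t *\<^sub>R h" "1/t"] t by simp
    then show ?thesis using t ppos_iff by (metis divide_pos_pos zero_less_one)
  qed
  define v where "v = cstar_sqrt h"
  have v: "v \<in> ppos" "v * v = h" using ppos_cstar_sqrt hp by (simp_all add: v_def)
  define s where "s = cinv v"
  have s: "s \<in> ppos" using v by (simp add: s_def)
  have vs: "v * (s * x * s) * v = x" "s * (v * x * v) * s = x" for x
    using v by (simp_all add: s_def mult.assoc cinv cinv_cancel)
  have \<phi>pp: "\<phi> x \<in> ppos" if x: "x \<in> ppos" for x
  proof -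
    obtain \<delta> where d: "\<delta> > 0" "\<delta> *\<^sub>R 1 \<preceq> x" using x ppos_iff by blast
    then have "\<delta> *\<^sub>R h \<preceq> \<phi> x" using ord[of "\<delta> *\<^sub>R 1" x] hom[of 1 \<delta>] x by (simp add: h_def pos_cone_scaleR)
    then show ?thesis using ppos_cle ppos_scaleR hp d by blast
  qed
  have \<phi>ipp: "\<phi>i y \<in> ppos" if y: "y \<in> ppos" for y
  proof -
    obtain t where t: "t > 0" "h \<preceq> t *\<^sub>R y" using ppos_dominates[of h y] y hp by auto
    then have "(1/t) *\<^sub>R h \<preceq> y" using cle_scaleR[of h "t *\<^sub>R y" "1/t"] by simp
    then have "(1/t) *\<^sub>R 1 \<preceq> \<phi>i y"
      using ord[of "(1/t) *\<^sub>R 1" "\<phi>i y"] hom[of 1 "1/t"] \<phi>ip[of y] y t by (simp add: h_def pos_cone_scaleR)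
    then show ?thesis using t ppos_iff by (metis divide_pos_pos zero_less_one)
  qed
  define \<psi> where "\<psi> x = s * \<phi> x * s" for x
  define \<psi>i where "\<psi>i y = \<phi>i (v * y * v)" for y
  interpret unital_gauge_iso \<psi> \<psi>i
  proof
    show "\<psi> 1 = 1" using v by (simp add: \<psi>_def h_def[symmetric] s_def mult.assoc[symmetric] v(2)[symmetric] cinv)
    show "gauge_iso \<psi> \<psi>i"
      unfolding gauge_iso_def
    proof (intro conjI ballI allI impI)
      show "\<psi> x \<in> ppos" "\<psi>i (\<psi> x) = x" if "x \<in> ppos" for x
        using that s \<phi>pp \<phi>p vs by (simp_all add: \<psi>_def \<psi>i_def)
      show "\<psi>i y \<in> ppos" "\<psi> (\<psi>i y) = y" if "y \<in> ppos" for y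
        using that v \<phi>ipp \<phi>ip[of "v * y * v"] vs by (simp_all add: \<psi>_def \<psi>i_def)
      fix x y :: 'a and t :: real assume xy: "x \<in> ppos" "y \<in> ppos" "0 < t"
      have "x \<preceq> t *\<^sub>R y \<longleftrightarrow> \<phi> x \<preceq> t *\<^sub>R \<phi> y" using ord[of x "t *\<^sub>R y"] hom[of y t] xy by (simp add: pos_cone_scaleR)
      also have "\<dots> \<longleftrightarrow> s * \<phi> x * s \<preceq> s * (t *\<^sub>R \<phi> y) * s"
        using s xy \<phi>pp by (intro cle_conj_iff[symmetric]) auto
      finally show "x \<preceq> t *\<^sub>R y \<longleftrightarrow> \<psi> x \<preceq> t *\<^sub>R \<psi> y" by (simp add: \<psi>_def)
    qed
  qed
  interpret inv: unital_gauge_iso \<psi>i \<psi> by (rule inverse_iso)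
  have shs: "s * h * s = 1" using unit by (simp add: \<psi>_def h_def)
  \<comment> \<open>So far the formula is known on \<open>ppos\<close> only. Perturbing
    \<open>x\<close> by \<open>\<epsilon>\<close> bounds \<open>\<phi> x\<close> from above; the
    lower bound comes from perturbing \<open>\<phi> x\<close> by \<open>\<epsilon> h\<close> and
    applying the inverse map, whose derivative undoes \<open>deriv_one\<close>.\<close>
  have \<phi>_eq: "\<phi> x = v * deriv_one x * v" if x: "x \<in> pos_cone" for x
  proof (rule cle_antisym)
    have sx: "selfadjoint x" using x sa_pos_cone by auto
    have spx: "selfadjoint (\<phi> x)" using x \<phi>p sa_pos_cone by auto
    show "\<phi> x \<preceq> v * deriv_one x * v"
    proof (rule cle_add_small)
      show "selfadjoint (v * deriv_one x * v)" using v sx deriv_one_sa by simp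
      show "h \<in> pos_cone" using hp by simp
      fix \<epsilon> :: real assume e: "\<epsilon> > 0"
      have P: "x + \<epsilon> *\<^sub>R 1 \<in> ppos" using x e by (intro pos_cone_add_ppos) auto
      have "x \<preceq> x + \<epsilon> *\<^sub>R 1" using cle_add_left[of 0 "\<epsilon> *\<^sub>R 1" x] sx e by (simp add: pos_cone_scaleR)
      then have "\<phi> x \<preceq> \<phi> (x + \<epsilon> *\<^sub>R 1)" using ord x P by simp
      also have "\<phi> (x + \<epsilon> *\<^sub>R 1) = v * \<psi> (x + \<epsilon> *\<^sub>R 1) * v" by (simp add: \<psi>_def vs)
      also have "\<dots> = v * (deriv_one x + \<epsilon> *\<^sub>R 1) * v"
        using map_eq_deriv_one[OF P] sx by (simp add: deriv_one_add deriv_one_scaleR deriv_one_one)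
      also have "\<dots> = v * deriv_one x * v + \<epsilon> *\<^sub>R h" using v by (simp add: algebra_simps)
      finally show "\<phi> x \<preceq> v * deriv_one x * v + \<epsilon> *\<^sub>R h" .
    qed
    have sy: "selfadjoint (s * \<phi> x * s)" using s spx by simp
    have "x \<preceq> inv.deriv_one (s * \<phi> x * s)"
    proof (rule cle_add_small)
      show "selfadjoint (inv.deriv_one (s * \<phi> x * s))" using sy by (rule inv.deriv_one_sa)
      show "1 \<in> pos_cone" by simp
      fix \<epsilon> :: real assume e: "\<epsilon> > 0"
      have P: "\<phi> x + \<epsilon> *\<^sub>R h \<in> ppos" using x e \<phi>p hp by (intro pos_cone_add_ppos) auto
      have "\<phi> x \<preceq> \<phi> x + \<epsilon> *\<^sub>R h"
        using cle_add_left[of 0 "\<epsilon> *\<^sub>R h" "\<phi> x"] spx e hp by (simp add: pos_cone_scaleR)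
      then have "x \<preceq> \<phi>i (\<phi> x + \<epsilon> *\<^sub>R h)" using ord[of x "\<phi>i (\<phi> x + \<epsilon> *\<^sub>R h)"] \<phi>ip[of "\<phi> x + \<epsilon> *\<^sub>R h"] x P by simp
      also have "\<phi>i (\<phi> x + \<epsilon> *\<^sub>R h) = \<psi>i (s * (\<phi> x + \<epsilon> *\<^sub>R h) * s)" by (simp add: \<psi>i_def vs)
      also have "\<dots> = inv.deriv_one (s * (\<phi> x + \<epsilon> *\<^sub>R h) * s)"
        using inv.map_eq_deriv_one ppos_conj[OF s P] by blast
      also have "s * (\<phi> x + \<epsilon> *\<^sub>R h) * s = s * \<phi> x * s + \<epsilon> *\<^sub>R 1" using shs by (simp add: distrib_left distrib_right)
      also have "inv.deriv_one \<dots> = inv.deriv_one (s * \<phi> x * s) + \<epsilon> *\<^sub>R 1"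
        using sy by (simp add: inv.deriv_one_add inv.deriv_one_scaleR inv.deriv_one_one)
      finally show "x \<preceq> inv.deriv_one (s * \<phi> x * s) + \<epsilon> *\<^sub>R 1" .
    qed
    then have "deriv_one x \<preceq> s * \<phi> x * s"
      using deriv_one_mono inv.deriv_one_inverse[OF sy] by fastforce
    then have "v * deriv_one x * v \<preceq> v * (s * \<phi> x * s) * v" using v by (intro cle_conj) auto
    then show "v * deriv_one x * v \<preceq> \<phi> x" by (simp only: vs)
  qed
  have "\<phi> x = cstar_sqrt (\<phi> 1) * jordan_ext x * cstar_sqrt (\<phi> 1)" if "x \<in> pos_cone" for x
    using \<phi>_eq[OF that] jordan_ext_sa[OF sa_pos_cone[OF that]] by (simp add: v_def h_def)
  then show ?thesis using jordan_star_iso_jordan_ext by blast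
qed

end
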